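(* Let $0<\beta<1$, let $X$ be the one-dimensional super-Brownian motion with $(1+\beta)$-stable branching mechanism started from $\delta_0$ (law $\mathbb P_{\delta_0}$), let $(L^x)_{x\in\mathbb R}$ be its total local time, and let $\mathsf L<0<\mathsf R$ be the finite random variables such that $\{x\in\mathbb R:L^x>0\}=(\mathsf L,\mathsf R)$ $\mathbb P_{\delta_0}$-a.s. If $\gamma>1+2/\beta$, then, $\mathbb P_{\delta_0}$-almost surely, the map $x\mapsto L^x$ fails the pointwise $\gamma$-Hölder condition at each of $\mathsf L$ and $\mathsf R$.
   Context: Fix $0<\beta<1$. $M_F$ is the space of finite measures on $\mathbb R$ with the weak topology, and $\mu(f)=\int f\,d\mu$. The super-Brownian motion $X=(X_t)_{t\ge0}$ with $(1+\beta)$-stable branching started from $X_0\in M_F$ (law $\mathbb P_{X_0}$, expectation $\mathbb E_{X_0}$) is the $M_F$-valued (càdlàg) strong Markov process with $$\mathbb E_{X_0}\Big[\exp\Big\{-X_t(\phi)-\int_0^tX_s(f)\,ds\Big\}\Big]=\exp\{-X_0(V_t)\}$$ for nonnegative bounded Borel $\phi,f$, where $V_t$ is the unique nonnegative solution of $V_t=P_t\phi+\int_0^tP_s(f-V_{t-s}^{1+\beta})\,ds$ (the mild form of $\partial_tV=\frac12\Delta V-V^{1+\beta}+f$, $V_0=\phi$), and $(P_t)$ is the Brownian semigroup (generator $\frac12\Delta$). The occupation measure $\int_0^tX_s(\cdot)\,ds$ has a density $L_t^x$, the local time, i.e. $\int_0^tX_s(\phi)\,ds=\int_{\mathbb R}\phi(x)L_t^x\,dx$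 for all nonnegative measurable $\phi$; one uses its jointly continuous version in $(t,x)$. The extinction time $\zeta=\inf\{t\ge0:X_t(1)=0\}$ is a.s. finite, and the total local time is $L^x=L^x_\infty=L^x_\zeta$. It is known that $\{x:L^x>0\}$ is a.s. a bounded open interval $(\mathsf L,\mathsf R)$ containing $0$. Pointwise Hölder condition: for $\gamma>0$, a function $f:\mathbb R\to\mathbb R$ satisfies the pointwise $\gamma$-Hölder condition at $x$ if there are constants $\delta,c>0$ such that $|f(y)-f(x)|\le c|y-x|^\gamma$ whenever $|y-x|<\delta$ (for $\gamma>1$ no polynomial is subtracted). *)

theory Defs
  imports "HOL-Probability.Probability"
begin

section \<open>Finite measures on the line with the weak topology\<close>

definition finite_borel_measures :: "real measure set" where
  "finite_borel_measures = {\<mu>. finite_measure \<mu> \<and> sets \<mu> = sets borel}"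

definition bounded_continuous_functions :: "(real \<Rightarrow> real) set" where
  "bounded_continuous_functions = {g. continuous_on UNIV g \<and> bounded (range g)}"

text \<open>The weak topology is the initial topology of the maps \<open>\<mu> \<mapsto> \<mu>(g)\<close> for \<open>g\<close> bounded and
  continuous.\<close>

definition weak_topology :: "real measure topology" where
  "weak_topology =
     pullback_topology finite_borel_measures
       (\<lambda>\<mu>. \<lambda>g\<in>bounded_continuous_functions. integral\<^sup>L \<mu> g)
       (product_topology (\<lambda>_. euclideanreal) bounded_continuous_functions)"

definition MF :: "real measure measure" where
  "MF = sigma finite_borel_measures {U. openin weak_topology U}"

lemma topspace_weak_topology: "topspace weak_topology = finite_borel_measures"
  by (auto simp: weak_topology_def topspace_pullback_topology)

lemma space_MF: "space MF = finite_borel_measures"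
  by (simp add: MF_def space_measure_of_conv)

lemma sets_MF:
  "sets MF = sigma_sets finite_borel_measures {U. openin weak_topology U}"
  unfolding MF_def
  by (rule sets_measure_of) (use openin_subset topspace_weak_topology in blast)

lemma return_in_finite_borel_measures: "return borel x \<in> finite_borel_measures"
  by (simp add: finite_borel_measures_def prob_space.finite_measure prob_space_return)

lemma continuous_map_weak_topology_integral:
  assumes "g \<in> bounded_continuous_functions"
  shows "continuous_map weak_topology euclideanreal (\<lambda>\<mu>. integral\<^sup>L \<mu> g)"
proof -
  have "continuous_map weak_topology
      (product_topology (\<lambda>_. euclideanreal) bounded_continuous_functions)
      (id \<circ> (\<lambda>\<mu>. \<lambda>g\<in>bounded_continuous_functions. integral\<^sup>L \<mu> g))"
    unfolding weak_topology_def by (intro continuous_map_pullback) simp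
  from continuous_map_compose[OF this continuous_map_product_projection[OF assms]]
  show ?thesis
    using assms by (simp add: o_def)
qed

lemma limitin_weak_topology:
  "limitin weak_topology Y \<mu> F \<longleftrightarrow>
     \<mu> \<in> finite_borel_measures \<and> (\<forall>\<^sub>F i in F. Y i \<in> finite_borel_measures) \<and>
     (\<forall>g\<in>bounded_continuous_functions. ((\<lambda>i. integral\<^sup>L (Y i) g) \<longlongrightarrow> integral\<^sup>L \<mu> g) F)"
    (is "?lhs \<longleftrightarrow> ?rhs")
proof
  assume l: ?lhs
  have "((\<lambda>i. integral\<^sup>L (Y i) g) \<longlongrightarrow> integral\<^sup>L \<mu> g) F"
    if "g \<in> bounded_continuous_functions" for g
    using continuous_map_limit[OF continuous_map_weak_topology_integral[OF that] l]
    by (simp add: o_def)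
  moreover have "\<forall>\<^sub>F i in F. Y i \<in> finite_borel_measures"
    using l openin_topspace[of weak_topology] limitin_topspace[OF l]
    by (auto simp: limitin_def topspace_weak_topology)
  ultimately show ?rhs
    using limitin_topspace[OF l] by (auto simp: topspace_weak_topology)
next
  assume r: ?rhs
  let ?e = "\<lambda>\<mu>. \<lambda>g\<in>bounded_continuous_functions. integral\<^sup>L \<mu> g"
  let ?T = "product_topology (\<lambda>_. euclideanreal) bounded_continuous_functions"
  have lim: "limitin ?T (\<lambda>i. ?e (Y i)) (?e \<mu>) F"
    using r by (auto simp: limitin_componentwise)
  show ?lhs
    unfolding limitin_def topspace_weak_topology
  proof (intro conjI allI impI)
    show "\<mu> \<in> finite_borel_measures" using r by simp
    fix U assume U: "openin weak_topology U \<and> \<mu> \<in> U"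
    then obtain W where W: "openin ?T W" "U = ?e -` W \<inter> finite_borel_measures"
      by (auto simp: weak_topology_def openin_pullback_topology)
    with lim U have "\<forall>\<^sub>F i in F. ?e (Y i) \<in> W"
      by (auto simp: limitin_def)
    moreover have "\<forall>\<^sub>F i in F. Y i \<in> finite_borel_measures" using r by simp
    ultimately show "\<forall>\<^sub>F i in F. Y i \<in> U"
      by eventually_elim (simp add: W)
  qed
qed

definition cadlag :: "(real \<Rightarrow> real measure) \<Rightarrow> bool" where
  "cadlag w \<longleftrightarrow>
     (\<forall>t\<ge>0. limitin weak_topology w (w t) (at_right t)) \<and>
     (\<forall>t>0. \<exists>\<mu>. limitin weak_topology w \<mu> (at_left t))"


section \<open>The log-Laplace equation\<close>

definition bounded_borel_nonneg :: "(real \<Rightarrow> real) \<Rightarrow> bool" where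
  "bounded_borel_nonneg \<phi> \<longleftrightarrow>
     \<phi> \<in> borel_measurable borel \<and> (\<forall>x. 0 \<le> \<phi> x) \<and> bounded (range \<phi>)"

text \<open>The second argument of \<^const>\<open>normal_density\<close> is the standard deviation, and the density
  degenerates to \<open>0\<close> at standard deviation \<open>0\<close>, hence the case distinction.\<close>

definition brownian_semigroup :: "real \<Rightarrow> (real \<Rightarrow> real) \<Rightarrow> real \<Rightarrow> real" where
  "brownian_semigroup t g x =
     (if t = 0 then g x else (LINT y|lborel. normal_density x (sqrt t) y * g y))"

text \<open>A nonnegative solution automatically satisfies
  \<open>V\<^sub>t \<le> P\<^sub>t \<phi> + \<integral>\<^sub>0\<^sup>t P\<^sub>s f ds\<close>, so it is bounded on bounded time intervals. This is required
  explicitly because the Bochner integral of a non-integrable function is \<open>0\<close> by convention.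
  Values at negative times play no role.\<close>

definition mild_solution ::
  "real \<Rightarrow> (real \<Rightarrow> real) \<Rightarrow> (real \<Rightarrow> real) \<Rightarrow> (real \<Rightarrow> real \<Rightarrow> real) \<Rightarrow> bool" where
  "mild_solution \<beta> \<phi> f V \<longleftrightarrow>
     (\<lambda>(t, x). V t x) \<in> borel_measurable borel \<and>
     (\<forall>t\<ge>0. \<forall>x. 0 \<le> V t x) \<and>
     (\<forall>T\<ge>0. \<exists>C. \<forall>t\<in>{0..T}. \<forall>x. V t x \<le> C) \<and>
     (\<forall>t\<ge>0. \<forall>x. V t x = brownian_semigroup t \<phi> x +
        (LINT s:{0..t}|lborel. brownian_semigroup s (\<lambda>y. f y - V (t - s) y powr (1 + \<beta>)) x))"


section \<open>Super-Brownian motion with stable branching\<close>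

text \<open>The Markov process is the family of laws \<open>P \<mu>\<close>, \<open>\<mu>\<close> a finite measure, of one process \<open>X\<close>
  on the measurable space \<open>N\<close>. The filtration is indexed by all reals, but only nonnegative times
  matter. The strong Markov property is stated for finite stopping times; the case of stopping
  times with values in \<open>[0, \<infinity>]\<close>, on the event that they are finite, follows by truncation.\<close>

locale super_brownian_motion = filtration "space N" F
  for N :: "'w measure" and F :: "real \<Rightarrow> 'w measure" +
  fixes \<beta> :: real
    and X :: "real \<Rightarrow> 'w \<Rightarrow> real measure"
    and P :: "real measure \<Rightarrow> 'w measure"
  assumes sets_F_subset: "\<And>t. sets (F t) \<subseteq> sets N"
    and adapted: "\<And>t. 0 \<le> t \<Longrightarrow> X t \<in> F t \<rightarrow>\<^sub>M MF"
    and cadlag_paths: "\<And>\<omega>. \<omega> \<in> space N \<Longrightarrow> cadlag (\<lambda>t. X t \<omega>)"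
    and prob_space_P: "\<And>\<mu>. \<mu> \<in> space MF \<Longrightarrow> prob_space (P \<mu>)"
    and sets_P: "\<And>\<mu>. \<mu> \<in> space MF \<Longrightarrow> sets (P \<mu>) = sets N"
    and start: "\<And>\<mu>. \<mu> \<in> space MF \<Longrightarrow> AE \<omega> in P \<mu>. X 0 \<omega> = \<mu>"
    and transition_kernel:
      "\<And>t. 0 \<le> t \<Longrightarrow> (\<lambda>\<mu>. distr (P \<mu>) MF (X t)) \<in> MF \<rightarrow>\<^sub>M prob_algebra MF"
    and strong_markov:
      "\<And>\<mu> T t B. \<mu> \<in> space MF \<Longrightarrow> stopping_time F T \<Longrightarrow> (\<And>\<omega>. \<omega> \<in> space N \<Longrightarrow> 0 \<le> T \<omega>) \<Longrightarrow>
         0 \<le> t \<Longrightarrow> B \<in> sets MF \<Longrightarrow>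
         AE \<omega> in P \<mu>.
           real_cond_exp (P \<mu>) (pre_sigma T) (indicat_real {\<omega> \<in> space N. X (T \<omega> + t) \<omega> \<in> B}) \<omega> =
           measure (P (X (T \<omega>) \<omega>)) {\<omega>' \<in> space N. X t \<omega>' \<in> B}"
    and laplace_functional:
      "\<And>\<mu> \<phi> f V t. \<mu> \<in> space MF \<Longrightarrow> bounded_borel_nonneg \<phi> \<Longrightarrow> bounded_borel_nonneg f \<Longrightarrow>
         mild_solution \<beta> \<phi> f V \<Longrightarrow> 0 \<le> t \<Longrightarrow>
         (LINT \<omega>|P \<mu>. exp (- integral\<^sup>L (X t \<omega>) \<phi> - (LINT s:{0..t}|lborel. integral\<^sup>L (X s \<omega>) f))) =
         exp (- integral\<^sup>L \<mu> (V t))"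


section \<open>Local time\<close>

text \<open>Nonnegativity has to be stated, since \<^const>\<open>ennreal\<close> truncates negative values to \<open>0\<close>.\<close>

definition jointly_continuous_local_time ::
  "'w measure \<Rightarrow> (real \<Rightarrow> 'w \<Rightarrow> real measure) \<Rightarrow> (real \<Rightarrow> real \<Rightarrow> 'w \<Rightarrow> real) \<Rightarrow> bool" where
  "jointly_continuous_local_time Q X L \<longleftrightarrow>
     (\<forall>t\<ge>0. \<forall>x. L t x \<in> borel_measurable Q) \<and>
     (AE \<omega> in Q.
        continuous_on ({0..} \<times> UNIV) (\<lambda>(t, x). L t x \<omega>) \<and>
        (\<forall>t\<ge>0. \<forall>x. 0 \<le> L t x \<omega>) \<and>
        (\<forall>t\<ge>0. \<forall>\<phi>\<in>borel_measurable borel.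
           (\<integral>\<^sup>+s\<in>{0..t}. (\<integral>\<^sup>+x. \<phi> x \<partial>X s \<omega>) \<partial>lborel) =
           (\<integral>\<^sup>+x. \<phi> x * ennreal (L t x \<omega>) \<partial>lborel)))"

definition extinction_time :: "(real \<Rightarrow> 'w \<Rightarrow> real measure) \<Rightarrow> 'w \<Rightarrow> ereal" where
  "extinction_time X \<omega> = (INF t\<in>{t. 0 \<le> t \<and> measure (X t \<omega>) UNIV = 0}. ereal t)"

text \<open>The extinction time is almost surely finite, so the value \<open>0\<close> of \<^const>\<open>real_of_ereal\<close> at
  \<open>\<infinity>\<close> only matters on a null set.\<close>

definition total_local_time ::
  "(real \<Rightarrow> 'w \<Rightarrow> real measure) \<Rightarrow> (real \<Rightarrow> real \<Rightarrow> 'w \<Rightarrow> real) \<Rightarrow> 'w \<Rightarrow> real \<Rightarrow> real" where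
  "total_local_time X L \<omega> x = L (real_of_ereal (extinction_time X \<omega>)) x \<omega>"


section \<open>Pointwise Hoelder condition\<close>

definition pointwise_holder :: "real \<Rightarrow> (real \<Rightarrow> real) \<Rightarrow> real \<Rightarrow> bool" where
  "pointwise_holder \<gamma> f x \<longleftrightarrow>
     (\<exists>\<delta>>0. \<exists>c>0. \<forall>y. \<bar>y - x\<bar> < \<delta> \<longrightarrow> \<bar>f y - f x\<bar> \<le> c * \<bar>y - x\<bar> powr \<gamma>)"

end

theory Submission
  imports Defs "HOL-Real_Asymp.Real_Asymp"
begin

text \<open>Let \<open>q = 2/\<beta>\<close>, let \<open>R\<close> be the right edge and \<open>M\<^sub>x\<close> the mass of the total local time to the right
  of \<open>x > 0\<close>. Taking \<open>\<phi> = V\<close> in the log-Laplace equation, where \<open>V\<close> is a bounded stationary solution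
  with source \<open>f\<close>, and letting \<open>t\<close> tend to infinity gives \<open>E exp(- \<integral> f(y) L\<^sup>y dy) = exp(- V(0))\<close>. The
  stationary solutions used here equal \<open>c (x + a - y) powr (-q)\<close> for \<open>y \<le> x\<close> and have a source of
  order \<open>a powr (-q-2)\<close> supported on \<open>y > x\<close>. Comparing the parameter \<open>a > 0\<close> with the limit
  \<open>a \<rightarrow> 0\<close>, in which the Laplace functional becomes \<open>P(M\<^sub>x = 0)\<close>, shows that
  \<open>0 < M\<^sub>x \<le> const * a powr (q+2)\<close> has probability \<open>O(a)\<close>, locally uniformly in \<open>x > 0\<close>.

  A \<open>\<gamma>\<close>-Hoelder condition at \<open>R\<close> forces \<open>0 < M\<^sub>x \<le> const * \<epsilon> powr (\<gamma>+1)\<close> at the last point \<open>x < R\<close>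
  of a grid of mesh \<open>\<epsilon>\<close>. The grid has \<open>O(1/\<epsilon>)\<close> points, each contributing probability
  \<open>O(\<epsilon> powr ((\<gamma>+1)/(q+2)))\<close>, and the total vanishes as \<open>\<epsilon> \<rightarrow> 0\<close> because \<open>\<gamma> + 1 > q + 2\<close>. The left edge
  is the mirror image, so everything carries a sign \<open>\<sigma> = \<plusminus>1\<close>.\<close>

section \<open>The heat semigroup\<close>

lemma integrable_std_normal_mult_bounded:
  fixes g :: "real \<Rightarrow> real"
  assumes [measurable]: "g \<in> borel_measurable borel" and "\<And>z. \<bar>g z\<bar> \<le> C"
  shows "integrable lborel (\<lambda>z. std_normal_density z * g z)"
proof (rule Bochner_Integration.integrable_bound[where f="\<lambda>z. C * std_normal_density z"])
  show "integrable lborel (\<lambda>z. C * std_normal_density z)"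
    by (intro integrable_mult_right integrable_normal_density) simp
  show "AE z in lborel. norm (std_normal_density z * g z) \<le> norm (C * std_normal_density z)"
  proof (intro AE_I2)
    fix z
    have "\<bar>g z\<bar> \<le> \<bar>C\<bar>" using assms(2)[of z] by linarith
    then show "norm (std_normal_density z * g z) \<le> norm (C * std_normal_density z)"
      using mult_right_mono[of "\<bar>g z\<bar>" "\<bar>C\<bar>" "std_normal_density z"]
      by (simp add: abs_mult mult.commute)
  qed
qed simp

lemma integral_std_normal_mult_const:
  "(LINT z|lborel. std_normal_density z * (c::real)) = c"
  using integral_normal_density[of 1 0] by simp

text \<open>Stein's identity. The standard normal density has derivative -z times itself, so the
  difference of the two integrands is the derivative of the density times \<open>g\<close>. Its
  integral over the line is a difference of limits at the two infinities, and both are 0 because the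
  density vanishes there and \<open>g\<close> is bounded.\<close>

lemma std_normal_stein:
  fixes g g' :: "real \<Rightarrow> real"
  assumes g: "\<And>z. (g has_real_derivative g' z) (at z)" and cont: "continuous_on UNIV g'"
    and C: "\<And>z. \<bar>g z\<bar> \<le> C" and C': "\<And>z. \<bar>g' z\<bar> \<le> C'"
  shows "(LINT z|lborel. std_normal_density z * (z * g z)) =
    (LINT z|lborel. std_normal_density z * g' z)"
proof -
  have cg: "continuous_on UNIV g"
    using g by (meson DERIV_isCont continuous_at_imp_continuous_on)
  have [measurable]: "g \<in> borel_measurable borel" "g' \<in> borel_measurable borel"
    using cg cont by (auto intro: borel_measurable_continuous_onI)
  have i1: "integrable lborel (\<lambda>z. std_normal_density z * g' z)"
    by (rule integrable_std_normal_mult_bounded[OF _ C']) simp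
  have i2: "integrable lborel (\<lambda>z. std_normal_density z * (z * g z))"
  proof (rule Bochner_Integration.integrable_bound[where f="\<lambda>z. C * (std_normal_density z * \<bar>z\<bar> ^ 1)"])
    show "integrable lborel (\<lambda>z. C * (std_normal_density z * \<bar>z\<bar> ^ 1))"
      by (intro integrable_mult_right integrable_std_normal_moment_abs)
    have "std_normal_density z * \<bar>z\<bar> * \<bar>g z\<bar> \<le> std_normal_density z * \<bar>z\<bar> * \<bar>C\<bar>" for z
      using C[of z] by (intro mult_left_mono) auto
    then show "AE z in lborel. norm (std_normal_density z * (z * g z))
        \<le> norm (C * (std_normal_density z * \<bar>z\<bar> ^ 1))"
      by (auto simp: abs_mult mult_ac)
  qed simp
  let ?F = "\<lambda>z. std_normal_density z * g z"
  let ?f = "\<lambda>z. std_normal_density z * g' z - std_normal_density z * (z * g z)"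
  have lim: "((\<lambda>z. std_normal_density z) \<longlongrightarrow> 0) at_top" "((\<lambda>z. std_normal_density z) \<longlongrightarrow> 0) at_bot"
    unfolding std_normal_density_def by real_asymp+
  have bd: "Bfun g F" for F
    using C by (intro BfunI[where K=C]) auto
  have "(LBINT z=-\<infinity>..\<infinity>. ?f z) = 0 - 0"
  proof (rule interval_integral_FTC_integrable[where F = ?F])
    fix z :: real
    have "(std_normal_density has_real_derivative - z * std_normal_density z) (at z)"
      unfolding std_normal_density_def
      by (auto intro!: derivative_eq_intros simp: field_simps power2_eq_square)
    from DERIV_mult[OF this g] show "(?F has_vector_derivative ?f z) (at z)"
      by (simp add: has_real_derivative_iff_has_vector_derivative algebra_simps)
    show "isCont ?f z"
      using cg cont unfolding std_normal_density_def
      by (intro continuous_intros) (auto simp: continuous_on_eq_continuous_at)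
  next
    show "set_integrable lborel (einterval (-\<infinity>) \<infinity>) ?f"
      using i1 i2 by (simp add: set_integrable_def)
    have "(?F \<longlongrightarrow> 0) at_bot" "(?F \<longlongrightarrow> 0) at_top"
      using lim[unfolded tendsto_Zfun_iff diff_zero]
      unfolding tendsto_Zfun_iff diff_zero
      by (auto intro!: bounded_bilinear.Zfun_prod_Bfun[OF bounded_bilinear_mult _ bd])
    then show "((?F \<circ> real_of_ereal) \<longlongrightarrow> 0) (at_right (-\<infinity>))"
      "((?F \<circ> real_of_ereal) \<longlongrightarrow> 0) (at_left \<infinity>)"
      by (simp_all only: ereal_tendsto_simps1)
  qed simp
  then have "(LINT z|lborel. ?f z) = 0"
    by (simp add: interval_lebesgue_integral_def set_lebesgue_integral_def)
  then show ?thesis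
    using i1 i2 by simp
qed

text \<open>Dominated convergence along sequences. This supplies the continuity down to r = 0 that
  the fundamental theorem of calculus uses below, at the point where \<open>sqrt\<close> has no
  derivative.\<close>

lemma continuous_on_std_normal_integral:
  fixes h :: "real \<Rightarrow> real"
  assumes cont: "continuous_on UNIV h" and C: "\<And>z. \<bar>h z\<bar> \<le> C"
  shows "continuous_on UNIV (\<lambda>r. LINT z|lborel. std_normal_density z * h (x + r * z))"
proof -
  have [measurable]: "h \<in> borel_measurable borel"
    using cont by (rule borel_measurable_continuous_onI)
  have "(\<lambda>n. LINT z|lborel. std_normal_density z * h (x + u n * z))
      \<longlonglongrightarrow> (LINT z|lborel. std_normal_density z * h (x + r * z))" if u: "u \<longlonglongrightarrow> r" for u r
  proof (rule integral_dominated_convergence[where w="\<lambda>z. C * std_normal_density z"])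
    show "integrable lborel (\<lambda>z. C * std_normal_density z)"
      by (intro integrable_mult_right integrable_normal_density) simp
    show "AE z in lborel. (\<lambda>n. std_normal_density z * h (x + u n * z))
        \<longlonglongrightarrow> std_normal_density z * h (x + r * z)"
    proof (intro AE_I2 tendsto_mult tendsto_const)
      fix z
      have "(\<lambda>n. x + u n * z) \<longlonglongrightarrow> x + r * z"
        using u by (intro tendsto_intros)
      then show "(\<lambda>n. h (x + u n * z)) \<longlonglongrightarrow> h (x + r * z)"
        using cont by (auto intro: isCont_tendsto_compose simp: continuous_on_eq_continuous_at)
    qed
    show "AE z in lborel. norm (std_normal_density z * h (x + u n * z)) \<le> C * std_normal_density z" for n
      using C by (intro AE_I2) (auto simp: abs_mult mult.commute[of _ "std_normal_density _"] mult.commute[of C] intro: mult_left_mono)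
  qed simp_all
  then show ?thesis
    by (auto simp: continuous_on_eq_continuous_at isCont_def tendsto_at_iff_sequentially o_def)
qed

text \<open>Differentiation under the integral: the Lipschitz bound on \<open>V\<close> dominates
  the difference quotients by \<open>C * \<bar>z\<bar>\<close> times the density. The derivative
  first appears with a factor z and \<open>V1\<close>; Stein's identity trades this z for one more
  derivative and the factor r.\<close>

lemma has_derivative_std_normal_integral:
  fixes V V1 V2 :: "real \<Rightarrow> real"
  assumes V: "\<And>z. (V has_real_derivative V1 z) (at z)"
    and V1: "\<And>z. (V1 has_real_derivative V2 z) (at z)"
    and cont: "continuous_on UNIV V2"
    and C: "\<And>z. \<bar>V z\<bar> \<le> C" "\<And>z. \<bar>V1 z\<bar> \<le> C" "\<And>z. \<bar>V2 z\<bar> \<le> C"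
  shows "((\<lambda>r. LINT z|lborel. std_normal_density z * V (x + r * z)) has_real_derivative
    r * (LINT z|lborel. std_normal_density z * V2 (x + r * z))) (at r)"
proof -
  have cV: "continuous_on UNIV V" "continuous_on UNIV V1"
    using V V1 by (meson DERIV_isCont continuous_at_imp_continuous_on)+
  have [measurable]: "V \<in> borel_measurable borel" "V1 \<in> borel_measurable borel"
    using cV by (auto intro: borel_measurable_continuous_onI)
  have C0: "0 \<le> C" using C(1)[of 0] by linarith
  have int: "integrable lborel (\<lambda>z. std_normal_density z * V (x + r * z))" for r
    by (rule integrable_std_normal_mult_bounded[OF _ C(1)]) simp
  have lip: "\<bar>V a - V b\<bar> \<le> C * \<bar>a - b\<bar>" for a b
    using field_differentiable_bound[of UNIV V V1 C a b] V C(2) by simp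
  let ?G = "\<lambda>r. LINT z|lborel. std_normal_density z * V (x + r * z)"
  have "(\<lambda>n. (?G (r + h n) - ?G r) / h n)
      \<longlonglongrightarrow> (LINT z|lborel. std_normal_density z * (z * V1 (x + r * z)))"
    if h: "h \<longlonglongrightarrow> 0" and h0: "\<And>n. h n \<noteq> 0" for h
  proof -
    have "(?G (r + h n) - ?G r) / h n =
        (LINT z|lborel. std_normal_density z * ((V (x + (r + h n) * z) - V (x + r * z)) / h n))" for n
    proof -
      have "(?G (r + h n) - ?G r) / h n = (LINT z|lborel. (std_normal_density z * V (x + (r + h n) * z)
          - std_normal_density z * V (x + r * z)) / h n)"
        using int by simp
      also have "\<dots> = (LINT z|lborel. std_normal_density z * ((V (x + (r + h n) * z) - V (x + r * z)) / h n))"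
        by (intro Bochner_Integration.integral_cong) (auto simp: diff_divide_distrib algebra_simps)
      finally show ?thesis .
    qed
    moreover have "(\<lambda>n. LINT z|lborel. std_normal_density z * ((V (x + (r + h n) * z) - V (x + r * z)) / h n))
        \<longlonglongrightarrow> (LINT z|lborel. std_normal_density z * (z * V1 (x + r * z)))"
    proof (rule integral_dominated_convergence[where w="\<lambda>z. C * (std_normal_density z * \<bar>z\<bar> ^ 1)"])
      show "integrable lborel (\<lambda>z. C * (std_normal_density z * \<bar>z\<bar> ^ 1))"
        by (intro integrable_mult_right integrable_std_normal_moment_abs)
      show "AE z in lborel. (\<lambda>n. std_normal_density z * ((V (x + (r + h n) * z) - V (x + r * z)) / h n))
          \<longlonglongrightarrow> std_normal_density z * (z * V1 (x + r * z))"
      proof (intro AE_I2 tendsto_mult tendsto_const)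
        fix z
        have "((\<lambda>r. x + r * z) has_real_derivative z) (at r)"
          by (auto intro!: derivative_eq_intros)
        from DERIV_chain2[OF V this]
        have "((\<lambda>r. V (x + r * z)) has_real_derivative z * V1 (x + r * z)) (at r)"
          by (simp only: mult.commute)
        then show "(\<lambda>n. (V (x + (r + h n) * z) - V (x + r * z)) / h n) \<longlonglongrightarrow> z * V1 (x + r * z)"
          using h h0 by (auto simp: DERIV_def tendsto_at_iff_sequentially o_def)
      qed
      show "AE z in lborel. norm (std_normal_density z * ((V (x + (r + h n) * z) - V (x + r * z)) / h n))
          \<le> C * (std_normal_density z * \<bar>z\<bar> ^ 1)" for n
      proof (intro AE_I2)
        fix z
        have "\<bar>V (x + (r + h n) * z) - V (x + r * z)\<bar> \<le> C * \<bar>h n * z\<bar>"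
          using lip[of "x + (r + h n) * z" "x + r * z"] by (simp add: algebra_simps)
        then have "\<bar>(V (x + (r + h n) * z) - V (x + r * z)) / h n\<bar> \<le> C * \<bar>z\<bar>"
          using h0[of n] by (simp add: abs_mult abs_divide divide_simps mult_ac)
        from mult_left_mono[OF this, of "std_normal_density z"]
        show "norm (std_normal_density z * ((V (x + (r + h n) * z) - V (x + r * z)) / h n))
          \<le> C * (std_normal_density z * \<bar>z\<bar> ^ 1)"
          by (simp add: abs_mult mult_ac)
      qed
    qed simp_all
    ultimately show ?thesis by (simp only:)
  qed
  then have "(?G has_real_derivative (LINT z|lborel. std_normal_density z * (z * V1 (x + r * z)))) (at r)"
    by (auto simp: DERIV_def tendsto_at_iff_sequentially o_def)
  also have "(LINT z|lborel. std_normal_density z * (z * V1 (x + r * z))) =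
      (LINT z|lborel. std_normal_density z * (r * V2 (x + r * z)))"
  proof (rule std_normal_stein)
    show "((\<lambda>z. V1 (x + r * z)) has_real_derivative r * V2 (x + r * z)) (at z)" for z
    proof -
      have "((\<lambda>z. x + r * z) has_real_derivative r) (at z)"
        by (auto intro!: derivative_eq_intros)
      from DERIV_chain2[OF V1 this] show ?thesis
        by (simp only: mult.commute)
    qed
    have "continuous_on UNIV (\<lambda>z. V2 (x + r * z))"
      by (rule continuous_on_compose2[OF cont]) (auto intro!: continuous_intros)
    then show "continuous_on UNIV (\<lambda>z. r * V2 (x + r * z))"
      by (intro continuous_intros)
    show "\<bar>V1 (x + r * z)\<bar> \<le> C" for z by (rule C)
    show "\<bar>r * V2 (x + r * z)\<bar> \<le> \<bar>r\<bar> * C" for z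
      using C(3) by (auto simp: abs_mult intro: mult_left_mono)
  qed
  also have "\<dots> = r * (LINT z|lborel. std_normal_density z * V2 (x + r * z))"
    by (subst integral_mult_right_zero[symmetric]) (simp add: mult_ac)
  finally show ?thesis .
qed

text \<open>The substitution y = x + sqrt t * z moves the time from the density into the argument.
  The formula also covers t = 0, because the density has total mass 1.\<close>

lemma brownian_semigroup_std_normal:
  assumes "0 \<le> t"
  shows "brownian_semigroup t g x = (LINT z|lborel. std_normal_density z * g (x + sqrt t * z))"
proof (cases "t = 0")
  case True
  then show ?thesis
    using integral_std_normal_mult_const[of "g x"] by (simp add: brownian_semigroup_def)
next
  case False
  with assms have t: "0 < t" by simp
  have d: "sqrt t * normal_density x (sqrt t) (x + sqrt t * z) = std_normal_density z" for z
    using t by (simp add: normal_density_def real_sqrt_mult power_mult_distrib)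
  have "brownian_semigroup t g x =
      sqrt t * (LINT z|lborel. normal_density x (sqrt t) (x + sqrt t * z) * g (x + sqrt t * z))"
    using t lborel_integral_real_affine[of "sqrt t" "\<lambda>y. normal_density x (sqrt t) y * g y" x]
    by (simp add: brownian_semigroup_def)
  also have "\<dots> = (LINT z|lborel. std_normal_density z * g (x + sqrt t * z))"
    by (subst integral_mult_right_zero[symmetric]) (simp only: mult.assoc[symmetric] d)
  finally show ?thesis .
qed

text \<open>In the variable \<open>r = sqrt s\<close> the map \<open>r \<mapsto> E V(x + r Z)\<close> has derivative
  \<open>r E V''(x + r Z)\<close> by Stein's identity.\<close>

lemma brownian_semigroup_dynkin:
  fixes V V1 V2 :: "real \<Rightarrow> real"
  assumes V: "\<And>z. (V has_real_derivative V1 z) (at z)"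
    and V1: "\<And>z. (V1 has_real_derivative V2 z) (at z)"
    and cont: "continuous_on UNIV V2"
    and C: "\<And>z. \<bar>V z\<bar> \<le> C" "\<And>z. \<bar>V1 z\<bar> \<le> C" "\<And>z. \<bar>V2 z\<bar> \<le> C"
    and t: "0 \<le> t"
  shows "V x = brownian_semigroup t V x +
    (LINT s:{0..t}|lborel. brownian_semigroup s (\<lambda>y. - (V2 y / 2)) x)"
proof -
  let ?G = "\<lambda>r. LINT z|lborel. std_normal_density z * V (x + r * z)"
  let ?H = "\<lambda>r. LINT z|lborel. std_normal_density z * V2 (x + r * z)"
  have cV: "continuous_on UNIV V"
    using V by (meson DERIV_isCont continuous_at_imp_continuous_on)
  have cG: "continuous_on {0..t} (\<lambda>s. ?G (sqrt s))"
    by (rule continuous_on_compose2[OF continuous_on_std_normal_integral[OF cV C(1)]])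
      (auto intro!: continuous_intros)
  have cH: "continuous_on {0..t} (\<lambda>s. ?H (sqrt s))"
    by (rule continuous_on_compose2[OF continuous_on_std_normal_integral[OF cont C(3)]])
      (auto intro!: continuous_intros)
  \<comment> \<open>The derivative 1/(2 sqrt s) of \<open>sqrt s\<close> cancels the factor r = sqrt
    s and leaves the 1/2 of the generator. This computation is valid for s > 0 only, hence the
    interior form of the theorem with continuity at the endpoints.\<close>
  have "((\<lambda>s. ?H (sqrt s) / 2) has_integral ?G (sqrt t) - ?G (sqrt 0)) {0..t}"
  proof (rule fundamental_theorem_of_calculus_interior[OF t cG])
    fix s assume s: "s \<in> {0<..<t}"
    have "((\<lambda>s. ?G (sqrt s)) has_real_derivative (sqrt s * ?H (sqrt s)) * (inverse (sqrt s) / 2)) (at s)"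
      using s by (intro DERIV_chain2[OF has_derivative_std_normal_integral[OF V V1 cont C]] DERIV_real_sqrt) simp
    then show "((\<lambda>s. ?G (sqrt s)) has_vector_derivative ?H (sqrt s) / 2) (at s)"
      using s by (simp add: has_real_derivative_iff_has_vector_derivative field_simps)
  qed
  moreover have "set_integrable lborel {0..t} (\<lambda>s. ?H (sqrt s) / 2)"
    using cH by (intro borel_integrable_atLeastAtMost' continuous_intros) auto
  ultimately have "(LINT s:{0..t}|lborel. ?H (sqrt s) / 2) = ?G (sqrt t) - ?G (sqrt 0)"
    by (simp only: set_borel_integral_eq_integral(2) integral_unique)
  moreover have "?G (sqrt 0) = V x"
    using integral_std_normal_mult_const[of "V x"] by simp
  moreover have "(LINT s:{0..t}|lborel. brownian_semigroup s (\<lambda>y. - (V2 y / 2)) x) =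
      (LINT s:{0..t}|lborel. - (?H (sqrt s) / 2))"
    by (rule set_lebesgue_integral_cong) (auto simp: brownian_semigroup_std_normal)
  moreover have "(LINT s:{0..t}|lborel. - (?H (sqrt s) / 2)) = - (LINT s:{0..t}|lborel. ?H (sqrt s) / 2)"
    by (simp add: set_lebesgue_integral_def)
  ultimately show ?thesis
    using t unfolding brownian_semigroup_std_normal[OF t] by linarith
qed

text \<open>The source is chosen so that f - V^(1+\<beta>) = -V''/2, which turns the mild equation
  for the time-independent \<open>V\<close> into Dynkin's formula.\<close>

lemma mild_solution_stationary:
  fixes V V1 V2 f :: "real \<Rightarrow> real"
  assumes V: "\<And>z. (V has_real_derivative V1 z) (at z)"
    and V1: "\<And>z. (V1 has_real_derivative V2 z) (at z)"
    and cont: "continuous_on UNIV V2"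
    and C: "\<And>z. \<bar>V z\<bar> \<le> C" "\<And>z. \<bar>V1 z\<bar> \<le> C" "\<And>z. \<bar>V2 z\<bar> \<le> C"
    and nonneg: "\<And>z. 0 \<le> V z"
    and f: "\<And>z. f z = V z powr (1 + \<beta>) - V2 z / 2"
  shows "mild_solution \<beta> V f (\<lambda>_. V)"
proof -
  have "continuous_on UNIV V"
    using V by (meson DERIV_isCont continuous_at_imp_continuous_on)
  then have [measurable]: "V \<in> borel_measurable borel"
    by (rule borel_measurable_continuous_onI)
  have meas: "(\<lambda>(t::real, x). V x) \<in> borel_measurable borel"
    unfolding borel_prod[symmetric] by simp
  have eq: "V x = brownian_semigroup t V x +
      (LINT s:{0..t}|lborel. brownian_semigroup s (\<lambda>y. f y - V y powr (1 + \<beta>)) x)" if "0 \<le> t" for t x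
  proof -
    have "(\<lambda>y. f y - V y powr (1 + \<beta>)) = (\<lambda>y. - (V2 y / 2))"
      by (simp add: f)
    then show ?thesis
      using brownian_semigroup_dynkin[OF V V1 cont C that, of x] by (simp only:)
  qed
  have bd: "\<exists>B. \<forall>t\<in>{0..T}. \<forall>x. V x \<le> B" for T :: real
    using C(1) abs_le_D1 by (intro exI[of _ C]) blast
  show ?thesis
    unfolding mild_solution_def by (intro conjI allI impI meas nonneg bd eq)
qed

section \<open>Stationary solutions\<close>

text \<open>At the seam the one-sided difference quotients are treated separately; equal values and
  equal derivatives at \<open>a\<close> make their limits agree.\<close>

lemma has_real_derivative_glue:
  fixes f g f' g' :: "real \<Rightarrow> real"
  assumes f: "\<And>x. x \<le> a \<Longrightarrow> (f has_real_derivative f' x) (at x)"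
    and g: "\<And>x. a \<le> x \<Longrightarrow> (g has_real_derivative g' x) (at x)"
    and eq: "f a = g a" "f' a = g' a"
  shows "((\<lambda>x. if x \<le> a then f x else g x) has_real_derivative (if x \<le> a then f' x else g' x)) (at x)"
proof -
  consider "x < a" | "a < x" | "x = a" by linarith
  then show ?thesis
  proof cases
    case 1
    show ?thesis
      by (rule has_field_derivative_transform_within_open[of f _ _ "{..<a}"]) (use 1 f[of x] in auto)
  next
    case 2
    show ?thesis
      by (rule has_field_derivative_transform_within_open[of g _ _ "{a<..}"]) (use 2 g[of x] in auto)
  next
    case 3
    let ?h = "\<lambda>x. if x \<le> a then f x else g x"
    have "((\<lambda>y. (f y - f a) / (y - a)) \<longlongrightarrow> f' a) (at_left a)"
      using f[of a] filterlim_at_split by (auto simp: has_field_derivative_iff)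
    then have "((\<lambda>y. (?h y - ?h a) / (y - a)) \<longlongrightarrow> f' a) (at_left a)"
      by (rule Lim_transform_eventually) (auto simp: eventually_at_filter)
    moreover have "((\<lambda>y. (g y - g a) / (y - a)) \<longlongrightarrow> f' a) (at_right a)"
      using g[of a] eq filterlim_at_split by (auto simp: has_field_derivative_iff)
    then have "((\<lambda>y. (?h y - ?h a) / (y - a)) \<longlongrightarrow> f' a) (at_right a)"
      by (rule Lim_transform_eventually) (auto simp: eventually_at_filter eq)
    ultimately show ?thesis
      using 3 filterlim_at_split by (auto simp: has_field_derivative_iff)
  qed
qed

text \<open>For \<open>z \<le> 0\<close> the profile solves \<open>W''/2 = W powr (1 + 2/q)\<close>
  if \<open>c powr (2/q) = q (q + 1)/2\<close>; for \<open>z > 0\<close> it is continued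
  by the exponential sum that matches two derivatives at \<open>0\<close>.\<close>

definition profile :: "real \<Rightarrow> real \<Rightarrow> real \<Rightarrow> real" where
  "profile c q z = (if z \<le> 0 then c * (1 - z) powr - q
     else c + c * q * (q + 3) * (1 - exp (- z)) - c * q * (q + 2) / 2 * (1 - (exp (- z))\<^sup>2))"

definition profile1 :: "real \<Rightarrow> real \<Rightarrow> real \<Rightarrow> real" where
  "profile1 c q z = (if z \<le> 0 then c * q * (1 - z) powr (- q - 1)
     else c * q * (q + 3) * exp (- z) - c * q * (q + 2) * (exp (- z))\<^sup>2)"

definition profile2 :: "real \<Rightarrow> real \<Rightarrow> real \<Rightarrow> real" where
  "profile2 c q z = (if z \<le> 0 then c * q * (q + 1) * (1 - z) powr (- q - 2)
     else 2 * c * q * (q + 2) * (exp (- z))\<^sup>2 - c * q * (q + 3) * exp (- z))"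

lemma DERIV_one_minus_powr:
  fixes r z :: real
  assumes "z \<le> 0"
  shows "((\<lambda>z. (1 - z) powr r) has_real_derivative - r * (1 - z) powr (r - 1)) (at z)"
  using assms by (auto intro!: derivative_eq_intros)

lemma DERIV_profile: "(profile c q has_real_derivative profile1 c q z) (at z)"
  unfolding profile_def[abs_def] profile1_def
  by (rule has_real_derivative_glue)
    (auto intro!: derivative_eq_intros DERIV_one_minus_powr simp: algebra_simps power2_eq_square)

lemma DERIV_profile1: "(profile1 c q has_real_derivative profile2 c q z) (at z)"
  unfolding profile1_def[abs_def] profile2_def
  by (rule has_real_derivative_glue)
    (auto intro!: derivative_eq_intros DERIV_one_minus_powr simp: algebra_simps power2_eq_square)

lemma continuous_on_profile2: "continuous_on UNIV (profile2 c q)"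
proof -
  have "continuous_on ({..0} \<union> {0..}) (profile2 c q)"
    unfolding profile2_def[abs_def]
    by (rule continuous_on_If) (auto intro!: continuous_intros simp: algebra_simps)
  moreover have "{..0} \<union> {0..} = (UNIV :: real set)" by auto
  ultimately show ?thesis by simp
qed

lemma one_minus_powr_bounds:
  fixes r z :: real
  assumes "z \<le> 0" "0 \<le> r"
  shows "0 \<le> (1 - z) powr - r" "(1 - z) powr - r \<le> 1"
  using assms powr_mono2'[of "-r" 1 "1 - z"] by auto

text \<open>A deliberately crude constant that serves the profile and its first two derivatives at
  once.\<close>

definition profile_bound :: "real \<Rightarrow> real \<Rightarrow> real" where
  "profile_bound c q = c + 3 * c * q * (q + 3)"

section \<open>Bounds and source term of the profile\<close>

context
  fixes c q :: real
  assumes c: "0 < c" and q: "0 < q"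
begin

text \<open>With u = exp(-z), the excess over c factors into c q (1 - u) and (q + 3) - (q + 2)(1 +
  u)/2, and the latter is nonnegative because 1 + u <= 2. Beyond the seam the power term therefore
  never falls below its value at the seam.\<close>

lemma profile_ge:
  assumes "0 \<le> z" shows "c \<le> profile c q z"
proof (cases "z = 0")
  case False
  with assms have z: "0 < z" by simp
  define u where "u = exp (- z)"
  have u: "0 < u" "u < 1" using z by (auto simp: u_def)
  have "profile c q z - c = c * q * (1 - u) * ((q + 3) - (q + 2) * (1 + u) / 2)"
    using z by (simp add: profile_def flip: u_def) (simp add: algebra_simps power2_eq_square add_divide_distrib diff_divide_distrib)
  moreover have "(q + 2) * (1 + u) \<le> (q + 2) * 2"
    using u q by (intro mult_left_mono) auto
  then have "0 \<le> (q + 3) - (q + 2) * (1 + u) / 2" by simp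
  ultimately show ?thesis
    using u c q by (smt (verit) mult_nonneg_nonneg)
qed (simp add: profile_def)

lemma profile_nonneg: "0 \<le> profile c q z"
proof (cases "z \<le> 0")
  case True
  then show ?thesis using c by (simp add: profile_def)
next
  case False
  then show ?thesis using profile_ge[of z] c by linarith
qed

lemma profile_bounds:
  "\<bar>profile c q z\<bar> \<le> profile_bound c q" "\<bar>profile1 c q z\<bar> \<le> profile_bound c q"
  "\<bar>profile2 c q z\<bar> \<le> profile_bound c q"
proof -
  have pos: "0 < c * q" "0 < c * q * q" using c q by auto
  consider "z \<le> 0" | "0 < z" by linarith
  then have "\<bar>profile c q z\<bar> \<le> profile_bound c q \<and> \<bar>profile1 c q z\<bar> \<le> profile_bound c q \<and>
      \<bar>profile2 c q z\<bar> \<le> profile_bound c q"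
  proof cases
    case 1
    note b = one_minus_powr_bounds[OF 1, of q] one_minus_powr_bounds[OF 1, of "q + 1"]
      one_minus_powr_bounds[OF 1, of "q + 2"]
    have "c * (1 - z) powr - q \<le> c * 1" "c * q * (1 - z) powr (- q - 1) \<le> c * q * 1"
      "c * q * (q + 1) * (1 - z) powr (- q - 2) \<le> c * q * (q + 1) * 1"
      using b c q by (intro mult_left_mono; simp)+
    moreover have "0 \<le> c * (1 - z) powr - q" "0 \<le> c * q * (1 - z) powr (- q - 1)"
      "0 \<le> c * q * (q + 1) * (1 - z) powr (- q - 2)"
      using b c q by (intro mult_nonneg_nonneg; simp)+
    moreover have "profile c q z = c * (1 - z) powr - q" "profile1 c q z = c * q * (1 - z) powr (- q - 1)"
      "profile2 c q z = c * q * (q + 1) * (1 - z) powr (- q - 2)"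
      "profile_bound c q = c + 3 * (c * q * q) + 9 * (c * q)" "c * q * (q + 1) = c * q * q + c * q"
      using 1 by (simp_all add: profile_def profile1_def profile2_def profile_bound_def algebra_simps)
    ultimately show ?thesis
      using c pos unfolding abs_le_iff mult_1_right by (intro conjI; linarith)
  next
    case 2
    define u where "u = exp (- z)"
    have u: "0 < u" "u < 1" using 2 by (auto simp: u_def)
    then have u2: "0 < u\<^sup>2" "u\<^sup>2 < 1" by (auto simp: power_less_one_iff)
    have m: "A * u \<le> A" "0 \<le> A * u" "A * u\<^sup>2 \<le> A" "0 \<le> A * u\<^sup>2" if "0 \<le> A" for A
      using u u2 that mult_left_mono[of u 1 A] mult_left_mono[of "u\<^sup>2" 1 A] by auto
    define A B where "A = c * q * (q + 3)" and "B = c * q * (q + 2)"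
    have A: "0 \<le> A" "0 \<le> B" "B \<le> A"
      using c q by (auto simp: A_def B_def)
    \<comment> \<open>In s and t all three functions are linear, so the bounds follow from 0 <= s <=
      A, 0 <= t <= B and B <= A by linear arithmetic.\<close>
    define s t where "s = A * u" and "t = B * u\<^sup>2"
    have "0 \<le> s" "s \<le> A" "0 \<le> t" "t \<le> B"
      using m[OF A(1)] m[OF A(2)] by (simp_all add: s_def t_def)
    moreover have "profile c q z = c + (A - s) - (B - t) / 2"
      "profile1 c q z = s - t"
      "profile2 c q z = 2 * t - s"
      "profile_bound c q = c + 3 * A"
      using 2 by (simp_all add: profile_def profile1_def profile2_def profile_bound_def u_def A_def B_def s_def t_def right_diff_distrib diff_divide_distrib)
    ultimately show ?thesis
      using c A unfolding abs_le_iff by (intro conjI; argo)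
  qed
  then show "\<bar>profile c q z\<bar> \<le> profile_bound c q" "\<bar>profile1 c q z\<bar> \<le> profile_bound c q"
    "\<bar>profile2 c q z\<bar> \<le> profile_bound c q" by auto
qed

text \<open>This is the exact power solution: q \<beta> = 2 makes the exponents -q(1+\<beta>) and
  -q-2 agree, and the equation for c matches the coefficients.\<close>

lemma profile_source_zero:
  assumes "z \<le> 0" and c_eq: "c powr \<beta> = q * (q + 1) / 2" and "q * \<beta> = 2"
  shows "profile c q z powr (1 + \<beta>) - profile2 c q z / 2 = 0"
proof -
  have "profile c q z powr (1 + \<beta>) = c powr (1 + \<beta>) * (1 - z) powr (- q * (1 + \<beta>))"
    using assms c by (simp add: profile_def powr_mult powr_powr)
  moreover have "- q * (1 + \<beta>) = - q - 2"
    using assms by (simp add: algebra_simps)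
  moreover have "c powr (1 + \<beta>) = c * (q * (q + 1) / 2)"
    using c c_eq by (simp add: powr_add)
  ultimately show ?thesis
    using assms by (simp add: profile2_def)
qed

text \<open>The power term is at least c^(1+\<beta>) = c q (q+1)/2 by \<open>profile_ge\<close>, and
  half the second derivative is at most c q (q+1)/2 times u^2 because u^2 <= u. The factor 1 - u^2
  remains and stays away from 0 at any fixed distance beyond the seam.\<close>

lemma profile_source_ge:
  assumes "0 \<le> z" and c_eq: "c powr \<beta> = q * (q + 1) / 2" and "0 < \<beta>"
  shows "c * q * (q + 1) / 2 * (1 - exp (- 2 * z)) \<le> profile c q z powr (1 + \<beta>) - profile2 c q z / 2"
proof -
  define u where "u = exp (- z)"
  have u: "0 < u" "u \<le> 1" using assms by (auto simp: u_def)
  have u2: "exp (- 2 * z) = u\<^sup>2" by (simp add: u_def power2_eq_square flip: exp_add)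
  have "c * (q * (q + 1) / 2) = c powr (1 + \<beta>)"
    using c c_eq by (simp add: powr_add)
  also have "\<dots> \<le> profile c q z powr (1 + \<beta>)"
    using profile_ge[OF assms(1)] c assms by (intro powr_mono2) auto
  finally have 1: "c * q * (q + 1) / 2 \<le> profile c q z powr (1 + \<beta>)" by (simp add: mult.assoc)
  have "profile2 c q z = 2 * c * q * (q + 2) * u\<^sup>2 - c * q * (q + 3) * u"
    using assms by (auto simp: profile2_def u_def algebra_simps)
  also have "\<dots> \<le> 2 * c * q * (q + 2) * u\<^sup>2 - c * q * (q + 3) * u\<^sup>2"
    using u c q by (intro diff_left_mono mult_left_mono) (auto simp: power2_eq_square intro: mult_left_le)
  also have "\<dots> = c * q * (q + 1) * u\<^sup>2"
    by (simp add: algebra_simps)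
  finally have "profile2 c q z \<le> c * q * (q + 1) * u\<^sup>2" .
  then show ?thesis
    using 1 unfolding u2 right_diff_distrib mult_1_right times_divide_eq_left by linarith
qed

end

text \<open>The solution is the profile W, reflected and rescaled: a^(-q) W((\<sigma> y - x)/a).
  Because q \<beta> = 2, the power term and the second derivative both scale like a^(-q-2), so the
  source is a^(-q-2) times a fixed function of the rescaled variable. Hence the constants depend on
  neither x nor a.\<close>

lemma stationary_solution_exists:
  fixes \<beta> \<sigma> :: real
  assumes \<beta>: "0 < \<beta>" and \<sigma>: "\<bar>\<sigma>\<bar> = 1"
  obtains c \<kappa> K :: real where "0 < c" "0 < \<kappa>" "0 < K"
    "\<And>x a. 0 \<le> x \<Longrightarrow> 0 < a \<Longrightarrow> \<exists>V f. mild_solution \<beta> V f (\<lambda>_. V) \<and> bounded_borel_nonneg V \<and>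
       continuous_on UNIV f \<and> (\<forall>y. 0 \<le> f y \<and> f y \<le> K * a powr (- (2 / \<beta>) - 2)) \<and>
       (\<forall>y. \<sigma> * y \<le> x \<longrightarrow> f y = 0) \<and>
       (\<forall>y. x \<le> \<sigma> * y \<longrightarrow>
         \<kappa> * a powr (- (2 / \<beta>) - 2) * (1 - exp (- 2 * ((\<sigma> * y - x) / a))) \<le> f y) \<and>
       V 0 = c * (x + a) powr - (2 / \<beta>)"
proof -
  define q where "q = 2 / \<beta>"
  define c where "c = (q * (q + 1) / 2) powr (1 / \<beta>)"
  have q: "0 < q" "q * \<beta> = 2" using \<beta> by (auto simp: q_def)
  have c: "0 < c" using q by (simp add: c_def)
  have c_eq: "c powr \<beta> = q * (q + 1) / 2"
    using q \<beta> by (simp add: c_def powr_powr)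
  define B where "B = profile_bound c q"
  define K where "K = B powr (1 + \<beta>) + B / 2"
  have B: "0 < B" using c q by (auto simp: B_def profile_bound_def intro!: add_pos_pos)
  let ?g = "\<lambda>z. profile c q z powr (1 + \<beta>) - profile2 c q z / 2"
  have g_le: "?g z \<le> K" for z
  proof -
    have "profile c q z powr (1 + \<beta>) \<le> B powr (1 + \<beta>)"
      using profile_nonneg[OF c q(1), of z] profile_bounds(1)[OF c q(1), of z] \<beta>
      unfolding B_def by (intro powr_mono2) auto
    then show ?thesis
      using profile_bounds(3)[OF c q(1), of z] unfolding K_def B_def by linarith
  qed
  have g_nonneg: "0 \<le> ?g z" for z
  proof (cases "z \<le> 0")
    case True
    then show ?thesis using profile_source_zero[OF c q(1) _ c_eq q(2)] by simp
  next
    case False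
    then have "0 \<le> c * q * (q + 1) / 2 * (1 - exp (- 2 * z))"
      using c q by (intro mult_nonneg_nonneg) auto
    then show ?thesis
      using profile_source_ge[OF c q(1) _ c_eq \<beta>, of z] False by linarith
  qed
  have "continuous_on UNIV (profile c q)"
    using DERIV_profile by (meson DERIV_isCont continuous_at_imp_continuous_on)
  then have cg: "continuous_on UNIV ?g"
    using continuous_on_profile2 profile_nonneg[OF c q(1)] \<beta>
    by (intro continuous_intros continuous_on_powr') (auto intro: continuous_intros)
  show ?thesis
  proof (rule that[of c "c * q * (q + 1) / 2" K])
    show "0 < c" "0 < c * q * (q + 1) / 2" "0 < K"
      using c q B by (auto simp: K_def intro!: add_pos_pos)
    fix x a :: real assume x: "0 \<le> x" and a: "0 < a"
    let ?z = "\<lambda>y. (\<sigma> * y - x) / a"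
    define A where "A = a powr - q"
    have A: "0 < A" "A powr (1 + \<beta>) = a powr (- q - 2)" "A * (1 / a)\<^sup>2 = a powr (- q - 2)"
    proof -
      have "- q * (1 + \<beta>) = - q - 2" using q by (simp add: algebra_simps)
      then show "A powr (1 + \<beta>) = a powr (- q - 2)"
        using a by (simp add: A_def powr_powr)
      show "A * (1 / a)\<^sup>2 = a powr (- q - 2)"
        using a by (simp add: A_def powr_diff power_divide field_simps powr_numeral)
    qed (use a in \<open>simp add: A_def\<close>)
    define V V1 V2 f where "V = (\<lambda>y. A * profile c q (?z y))"
      and "V1 = (\<lambda>y. A * (\<sigma> / a) * profile1 c q (?z y))"
      and "V2 = (\<lambda>y. a powr (- q - 2) * profile2 c q (?z y))"
      and "f = (\<lambda>y. a powr (- q - 2) * ?g (?z y))"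
    have z': "(?z has_real_derivative \<sigma> / a) (at y)" for y
      using a by (auto intro!: derivative_eq_intros)
    have V: "(V has_real_derivative V1 y) (at y)" for y
      unfolding V_def V1_def
      by (rule DERIV_cong[OF DERIV_cmult[OF DERIV_chain2[OF DERIV_profile z']]]) simp
    have V1: "(V1 has_real_derivative V2 y) (at y)" for y
    proof -
      \<comment> \<open>The reflection drops out of the second derivative, so both edges share one
        equation.\<close>
      have "\<sigma>\<^sup>2 = 1" using \<sigma> by (metis power2_abs one_power2)
      then have "A * (\<sigma> / a) * (\<sigma> / a) = a powr (- q - 2)"
        using A(3) by (simp add: power2_eq_square field_simps)
      then have "A * (\<sigma> / a) * (p * (\<sigma> / a)) = a powr (- q - 2) * p" for p
        by (metis mult.assoc mult.commute)
      then show ?thesis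
        unfolding V1_def V2_def
        by (intro DERIV_cong[OF DERIV_cmult[OF DERIV_chain2[OF DERIV_profile1 z']]])
    qed
    have V0: "0 \<le> V y" for y
      using A profile_nonneg[OF c q(1)] by (simp add: V_def)
    have cz: "continuous_on UNIV ?z"
      using a by (intro continuous_intros) auto
    have cV2: "continuous_on UNIV V2"
      unfolding V2_def
      by (intro continuous_intros continuous_on_compose2[OF continuous_on_profile2 cz]) auto
    define C where "C = max (A * B) (max (A * (1 / a) * B) (a powr (- q - 2) * B))"
    have b0: "\<bar>V y\<bar> \<le> A * B" "\<bar>V1 y\<bar> \<le> A * (1 / a) * B" "\<bar>V2 y\<bar> \<le> a powr (- q - 2) * B" for y
      using profile_bounds[OF c q(1), of "?z y"] A a \<sigma>
      unfolding V_def V1_def V2_def B_def abs_mult by (auto intro!: mult_left_mono divide_right_mono)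
    have b: "\<bar>V y\<bar> \<le> C" "\<bar>V1 y\<bar> \<le> C" "\<bar>V2 y\<bar> \<le> C" for y
      using b0[of y] unfolding C_def by linarith+
    have f: "f y = V y powr (1 + \<beta>) - V2 y / 2" for y
      using A profile_nonneg[OF c q(1)] by (simp add: f_def V_def V2_def powr_mult algebra_simps)
    have "mild_solution \<beta> V f (\<lambda>_. V)"
      by (rule mild_solution_stationary[OF V V1 cV2 b V0 f])
    moreover have "continuous_on UNIV V"
      using V by (meson DERIV_isCont continuous_at_imp_continuous_on)
    then have "bounded_borel_nonneg V"
      unfolding bounded_borel_nonneg_def using V0 b(1)
      by (auto intro: borel_measurable_continuous_onI simp: bounded_iff)
    moreover have "continuous_on UNIV f"
      unfolding f_def by (intro continuous_on_mult continuous_on_const continuous_on_compose2[OF cg cz]) auto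
    moreover have "0 \<le> f y \<and> f y \<le> K * a powr (- q - 2)" for y
      using g_nonneg[of "?z y"] g_le[of "?z y"] a unfolding f_def
      by (auto simp: mult.commute[of K] intro: mult_left_mono)
    moreover have "f y = 0" if "\<sigma> * y \<le> x" for y
      using profile_source_zero[OF c q(1) _ c_eq q(2), of "?z y"] that a
      by (simp add: f_def divide_nonpos_pos)
    moreover have "c * q * (q + 1) / 2 * a powr (- q - 2) * (1 - exp (- 2 * ?z y)) \<le> f y"
      if "x \<le> \<sigma> * y" for y
    proof -
      have "0 \<le> ?z y" using that a by simp
      from mult_left_mono[OF profile_source_ge[OF c q(1) this c_eq \<beta>], of "a powr (- q - 2)"]
      show ?thesis by (simp add: f_def mult_ac)
    qed
    \<comment> \<open>As x >= 0, the origin lies on the power-law side of the seam.\<close>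
    moreover have "V 0 = c * (x + a) powr - q"
    proof -
      have "V 0 = A * (c * (1 + x / a) powr - q)"
        using x a by (simp add: V_def profile_def)
      also have "1 + x / a = (x + a) / a" using a by (simp add: field_simps)
      also have "A * (c * ((x + a) / a) powr - q) = c * (x + a) powr - q"
        using x a by (simp add: A_def powr_divide)
      finally show ?thesis .
    qed
    ultimately show "\<exists>V f. mild_solution \<beta> V f (\<lambda>_. V) \<and> bounded_borel_nonneg V \<and>
       continuous_on UNIV f \<and> (\<forall>y. 0 \<le> f y \<and> f y \<le> K * a powr (- (2 / \<beta>) - 2)) \<and>
       (\<forall>y. \<sigma> * y \<le> x \<longrightarrow> f y = 0) \<and>
       (\<forall>y. x \<le> \<sigma> * y \<longrightarrow>
         c * q * (q + 1) / 2 * a powr (- (2 / \<beta>) - 2) * (1 - exp (- 2 * ((\<sigma> * y - x) / a))) \<le> f y) \<and>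
       V 0 = c * (x + a) powr - (2 / \<beta>)"
      unfolding q_def[symmetric] by (intro exI[of _ V] exI[of _ f] conjI allI impI) blast+
  qed
qed

section \<open>Absorption at the zero measure\<close>

text \<open>A right-continuous function is a pointwise limit of step functions that sample it at
  grid points to the right of t.\<close>

lemma right_continuous_borel_measurable:
  fixes g :: "real \<Rightarrow> real"
  assumes "\<And>t. (g \<longlongrightarrow> g t) (at_right t)"
  shows "g \<in> borel_measurable borel"
proof (rule borel_measurable_LIMSEQ_real)
  \<comment> \<open>The grid has mesh 1/(n+1). The \<open>+ 1\<close> puts the sample strictly to
    the right of t, as \<open>at_right t\<close> excludes t itself.\<close>
  let ?r = "\<lambda>n t. (of_int \<lfloor>real (Suc n) * t\<rfloor> + 1) / real (Suc n)"
  show "(\<lambda>n. g (?r n t)) \<longlonglongrightarrow> g t" for t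
  proof -
    have gt: "t < ?r n t" for n
      using floor_correct[of "real (Suc n) * t"]
      by (auto simp: pos_less_divide_eq mult.commute simp del: of_nat_Suc)
    have le: "?r n t \<le> t + inverse (real (Suc n))" for n
    proof -
      have "?r n t \<le> (real (Suc n) * t + 1) / real (Suc n)"
        by (intro divide_right_mono) auto
      also have "\<dots> = t + inverse (real (Suc n))"
        by (simp add: field_simps)
      finally show ?thesis .
    qed
    have "(\<lambda>n. ?r n t) \<longlonglongrightarrow> t"
    proof (rule tendsto_sandwich[where f="\<lambda>_. t" and h="\<lambda>n. t + inverse (real (Suc n))"])
      show "(\<lambda>n. t + inverse (real (Suc n))) \<longlonglongrightarrow> t"
        using tendsto_add[OF tendsto_const LIMSEQ_inverse_real_of_nat, of t] by simp
      show "\<forall>\<^sub>F n in sequentially. t \<le> ?r n t" "\<forall>\<^sub>F n in sequentially. ?r n t \<le> t + inverse (real (Suc n))"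
        using gt le by (auto intro!: always_eventually less_imp_le simp del: of_nat_Suc)
    qed simp
    then have "filterlim (\<lambda>n. ?r n t) (at_right t) sequentially"
      using gt less_imp_neq[OF gt, symmetric]
      by (auto simp: filterlim_at intro!: always_eventually simp del: of_nat_Suc)
    from filterlim_compose[OF assms this] show ?thesis .
  qed
  show "(\<lambda>t. g (?r n t)) \<in> borel_measurable borel" for n
  proof (rule measurable_compose[where f="\<lambda>t. \<lfloor>real (Suc n) * t\<rfloor>" and N="count_space UNIV"])
    show "(\<lambda>t. \<lfloor>real (Suc n) * t\<rfloor>) \<in> borel \<rightarrow>\<^sub>M count_space UNIV" by measurable
  qed simp
qed

section \<open>Cadlag paths of measures and their total mass\<close>

lemma bounded_continuous_functionsI:
  assumes "continuous_on UNIV g" and "\<And>x. \<bar>g x\<bar> \<le> C"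
  shows "g \<in> bounded_continuous_functions"
  using assms by (auto simp: bounded_continuous_functions_def bounded_iff)

lemma cadlag_finite_borel_measure:
  assumes "cadlag w" "0 \<le> t" shows "w t \<in> finite_borel_measures"
  using assms by (auto simp: cadlag_def limitin_weak_topology)

lemma cadlag_integral_tendsto_at_right:
  assumes "cadlag w" "0 \<le> t" "g \<in> bounded_continuous_functions"
  shows "((\<lambda>s. integral\<^sup>L (w s) g) \<longlongrightarrow> integral\<^sup>L (w t) g) (at_right t)"
  using assms by (auto simp: cadlag_def limitin_weak_topology)

text \<open>Right-continuity in time gives measurability; the indicator cuts off negative times,
  about which \<open>cadlag\<close> says nothing.\<close>

lemma cadlag_integral_measurable:
  assumes w: "cadlag w" and g: "g \<in> bounded_continuous_functions"
  shows "(\<lambda>s. indicator {0..} s * integral\<^sup>L (w s) g) \<in> borel_measurable borel"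
proof (rule right_continuous_borel_measurable)
  fix t :: real
  let ?h = "\<lambda>s. indicator {0..} s * integral\<^sup>L (w s) g"
  show "(?h \<longlongrightarrow> ?h t) (at_right t)"
  proof (cases "0 \<le> t")
    case True
    have "\<forall>\<^sub>F s in at_right t. integral\<^sup>L (w s) g = ?h s"
      using True by (auto simp: eventually_at_filter intro!: always_eventually)
    then show ?thesis
      using cadlag_integral_tendsto_at_right[OF w True g] True
      by (auto intro: Lim_transform_eventually)
  next
    case False
    then have "t < 0" by simp
    then have "\<forall>\<^sub>F s in at_right t. s \<in> {t<..<0}"
      by (rule eventually_at_right_real)
    then have "\<forall>\<^sub>F s in at_right t. 0 = ?h s"
      by eventually_elim auto
    with tendsto_const[of 0 "at_right t"] show ?thesis
      using False by (auto intro: Lim_transform_eventually)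
  qed
qed

lemma one_bounded_continuous: "(\<lambda>_. 1) \<in> bounded_continuous_functions"
  by (rule bounded_continuous_functionsI[where C = 1]) auto

lemma integral_one_finite_borel_measure:
  assumes "\<mu> \<in> finite_borel_measures"
  shows "integral\<^sup>L \<mu> (\<lambda>_. 1 :: real) = measure \<mu> UNIV"
proof -
  have "space \<mu> = UNIV"
    using assms sets_eq_imp_space_eq[of \<mu> borel] by (auto simp: finite_borel_measures_def)
  then show ?thesis by simp
qed

lemma measurable_MF_measure_UNIV: "(\<lambda>\<mu>. measure \<mu> UNIV) \<in> borel_measurable MF"
proof (rule borel_measurableI)
  fix S :: "real set" assume "open S"
  then have "openin weak_topology {\<mu> \<in> topspace weak_topology. integral\<^sup>L \<mu> (\<lambda>_. 1 :: real) \<in> S}"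
    using openin_continuous_map_preimage[OF continuous_map_weak_topology_integral[OF one_bounded_continuous]]
    by simp
  then have "{\<mu> \<in> finite_borel_measures. integral\<^sup>L \<mu> (\<lambda>_. 1 :: real) \<in> S} \<in> sets MF"
    unfolding sets_MF topspace_weak_topology by (intro sigma_sets.Basic) simp
  moreover have "{\<mu> \<in> finite_borel_measures. integral\<^sup>L \<mu> (\<lambda>_. 1 :: real) \<in> S} =
      (\<lambda>\<mu>. measure \<mu> UNIV) -` S \<inter> space MF"
    unfolding space_MF vimage_def by (auto simp only: integral_one_finite_borel_measure)
  ultimately show "(\<lambda>\<mu>. measure \<mu> UNIV) -` S \<inter> space MF \<in> sets MF" by simp
qed

text \<open>With \<phi> = f = 1 the reaction term cancels the source, so the constant 1 is
  stationary. This explicit solution is what controls the total mass below.\<close>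

lemma mild_solution_one: "mild_solution \<beta> (\<lambda>_. 1) (\<lambda>_. 1) (\<lambda>_ _. 1)"
proof -
  have z: "brownian_semigroup s (\<lambda>_. 0) x = 0" for s x
    by (simp add: brownian_semigroup_def)
  have o: "brownian_semigroup s (\<lambda>_. 1) x = 1" if "0 \<le> s" for s x
    using that integral_normal_density[of "sqrt s" x] by (simp add: brownian_semigroup_def)
  show ?thesis
    unfolding mild_solution_def by (auto simp: z o set_lebesgue_integral_def intro!: exI[of _ 1])
qed

section \<open>Tail bounds for the total mass\<close>

context super_brownian_motion
begin

lemma space_P: "\<mu> \<in> space MF \<Longrightarrow> space (P \<mu>) = space N"
  using sets_P sets_eq_imp_space_eq by blast

lemma X_in_space_MF: "\<omega> \<in> space N \<Longrightarrow> 0 \<le> t \<Longrightarrow> X t \<omega> \<in> space MF"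
  using cadlag_finite_borel_measure[OF cadlag_paths] by (simp add: space_MF)

lemma measurable_total_mass: "0 \<le> t \<Longrightarrow> (\<lambda>\<omega>. measure (X t \<omega>) UNIV) \<in> borel_measurable (F t)"
  using measurable_compose[OF adapted measurable_MF_measure_UNIV] .

lemma measurable_F_P: "\<mu> \<in> space MF \<Longrightarrow> f \<in> borel_measurable (F t) \<Longrightarrow> f \<in> borel_measurable (P \<mu>)"
  using sets_F_subset[of t] sets_P[of \<mu>] space_P[of \<mu>] space_F[of t]
  by (auto simp: measurable_def)

text \<open>Markov's inequality for one minus the Laplace exponential with \<phi> = f = 1. The
  occupation term only lowers that exponential, so the difference is at least 1 - exp(-d) on the
  event. The bound is uniform in t and linear in the initial mass.\<close>

lemma mass_tail_le:
  assumes \<mu>: "\<mu> \<in> space MF" and t: "0 \<le> t" and d: "0 < d"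
  shows "measure (P \<mu>) {\<omega> \<in> space N. d < measure (X t \<omega>) UNIV} \<le> measure \<mu> UNIV / (1 - exp (- d))"
proof -
  interpret p: prob_space "P \<mu>" by (rule prob_space_P[OF \<mu>])
  let ?m = "\<lambda>\<omega>. measure (X t \<omega>) UNIV"
  have m[measurable]: "?m \<in> borel_measurable (P \<mu>)"
    using measurable_F_P[OF \<mu> measurable_total_mass[OF t]] .
  let ?Z = "\<lambda>\<omega>. exp (- integral\<^sup>L (X t \<omega>) (\<lambda>_. 1 :: real) - (LINT s:{0..t}|lborel. integral\<^sup>L (X s \<omega>) (\<lambda>_. 1)))"
  have b1: "bounded_borel_nonneg (\<lambda>_. 1)"
    by (simp add: bounded_borel_nonneg_def)
  have eq: "integral\<^sup>L (P \<mu>) ?Z = exp (- measure \<mu> UNIV)"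
    using laplace_functional[OF \<mu> b1 b1 mild_solution_one t]
      integral_one_finite_borel_measure[of \<mu>] \<mu> by (simp only: space_MF)
  \<comment> \<open>A non-integrable function has Bochner integral 0, while the Laplace functional
    is positive. This gives integrability, and with it measurability, of a functional of the path up
    to time t.\<close>
  have intZ: "integrable (P \<mu>) ?Z"
  proof (rule ccontr)
    assume "\<not> integrable (P \<mu>) ?Z"
    have "exp (- measure \<mu> UNIV) = 0"
      by (rule trans[OF eq[symmetric] not_integrable_integral_eq[OF \<open>\<not> integrable (P \<mu>) ?Z\<close>]])
    then show False by simp
  qed
  have le: "indicator {\<omega> \<in> space N. d < ?m \<omega>} \<omega> * (1 - exp (- d)) \<le> 1 - ?Z \<omega>" if "\<omega> \<in> space N" for \<omega>
  proof -
    have m1: "integral\<^sup>L (X t \<omega>) (\<lambda>_. 1) = ?m \<omega>"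
      using X_in_space_MF[OF that t] by (simp only: integral_one_finite_borel_measure space_MF)
    have "0 \<le> (LINT s:{0..t}|lborel. integral\<^sup>L (X s \<omega>) (\<lambda>_. 1 :: real))"
      unfolding set_lebesgue_integral_def by (intro integral_nonneg_AE AE_I2) auto
    then have "?Z \<omega> \<le> exp (- ?m \<omega>)" unfolding m1 by simp
    moreover have "indicator {\<omega> \<in> space N. d < ?m \<omega>} \<omega> * (1 - exp (- d)) \<le> 1 - exp (- ?m \<omega>)"
      by (auto simp: indicator_def)
    ultimately show ?thesis by linarith
  qed
  have S: "{\<omega> \<in> space N. d < ?m \<omega>} \<in> sets (P \<mu>)"
    unfolding space_P[OF \<mu>, symmetric] by measurable
  have "measure (P \<mu>) {\<omega> \<in> space N. d < ?m \<omega>} * (1 - exp (- d)) =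
      (LINT \<omega>|P \<mu>. indicator {\<omega> \<in> space N. d < ?m \<omega>} \<omega> * (1 - exp (- d)))"
    using S by simp
  also have "\<dots> \<le> (LINT \<omega>|P \<mu>. 1 - ?Z \<omega>)"
    using le space_P[OF \<mu>] S intZ
    by (intro integral_mono) (auto intro!: integrable_real_indicator simp: p.emeasure_eq_measure)
  also have "\<dots> = 1 - exp (- measure \<mu> UNIV)"
    using intZ eq p.prob_space by simp
  also have "\<dots> \<le> measure \<mu> UNIV"
    using exp_ge_add_one_self[of "- measure \<mu> UNIV"] by linarith
  finally show ?thesis
    using d by (simp add: field_simps)
qed

text \<open>The Markov property at the deterministic time s: on \<open>A\<close> the conditional
  probability is a tail probability for the process restarted from its state at s, whose mass is at
  most \<epsilon>, so \<open>mass_tail_le\<close> applies. Integrating over \<open>A\<close> keeps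
  the factor P(A), which can then be summed over disjoint events.\<close>

lemma markov_mass_tail_le:
  assumes \<mu>: "\<mu> \<in> space MF" and st: "0 \<le> s" "s \<le> t" and d: "0 < d" and A: "A \<in> sets (F s)"
    and small: "\<And>\<omega>. \<omega> \<in> A \<Longrightarrow> measure (X s \<omega>) UNIV \<le> \<epsilon>"
  shows "measure (P \<mu>) (A \<inter> {\<omega> \<in> space N. d < measure (X t \<omega>) UNIV})
    \<le> \<epsilon> / (1 - exp (- d)) * measure (P \<mu>) A"
proof -
  interpret p: prob_space "P \<mu>" by (rule prob_space_P[OF \<mu>])
  have stop: "stopping_time F (\<lambda>_. s)" by (rule stopping_time_const)
  let ?G = "pre_sigma (\<lambda>_. s)"
  have sub: "subalgebra (P \<mu>) ?G"
  proof (unfold subalgebra_def, intro conjI subsetI)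
    show "space ?G = space (P \<mu>)" by (simp add: space_pre_sigma space_P[OF \<mu>])
    fix B assume "B \<in> sets ?G"
    from sets_pre_sigmaD[OF stop this, of s] have "B \<in> sets (F s)" by simp
    then show "B \<in> sets (P \<mu>)" using sets_F_subset sets_P[OF \<mu>] by auto
  qed
  interpret fs: finite_measure_subalgebra "P \<mu>" ?G
    using sub by unfold_locales
  have AG: "A \<in> sets ?G"
  proof (rule sets_pre_sigmaI[OF stop])
    fix u show "{\<omega> \<in> A. s \<le> u} \<in> sets (F u)"
      using A sets_F_mono[of s u] by (cases "s \<le> u") auto
  qed
  have AP: "A \<in> sets (P \<mu>)" using A sets_F_subset sets_P[OF \<mu>] by auto
  let ?D = "{\<omega> \<in> space N. d < measure (X t \<omega>) UNIV}"
  let ?B = "{\<nu> \<in> space MF. d < measure \<nu> UNIV}"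
  have B: "?B \<in> sets MF" using measurable_MF_measure_UNIV by measurable
  have D: "?D = {\<omega> \<in> space N. X (s + (t - s)) \<omega> \<in> ?B}"
    using X_in_space_MF st by auto
  have DP: "?D \<in> sets (P \<mu>)"
  proof -
    have [measurable]: "(\<lambda>\<omega>. measure (X t \<omega>) UNIV) \<in> borel_measurable (P \<mu>)"
      using measurable_F_P[OF \<mu> measurable_total_mass[of t]] st by simp
    show ?thesis unfolding space_P[OF \<mu>, symmetric] by measurable
  qed
  have ce: "AE \<omega> in P \<mu>. real_cond_exp (P \<mu>) ?G (indicat_real ?D) \<omega> =
      measure (P (X s \<omega>)) {\<omega>' \<in> space N. X (t - s) \<omega>' \<in> ?B}"
    unfolding D using strong_markov[OF \<mu> stop _ _ B, of "t - s"] st by simp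
  have intD: "integrable (P \<mu>) (indicat_real ?D)"
    using DP by (intro integrable_real_indicator) (auto simp: p.emeasure_eq_measure)
  have "measure (P \<mu>) (A \<inter> ?D) = (LINT \<omega>:A|P \<mu>. indicat_real ?D \<omega>)"
    using AP DP by (simp add: set_lebesgue_integral_def flip: indicator_inter_arith)
  also have "\<dots> = (LINT \<omega>:A|P \<mu>. real_cond_exp (P \<mu>) ?G (indicat_real ?D) \<omega>)"
    by (rule fs.real_cond_exp_intA[OF intD AG])
  also have "\<dots> \<le> (LINT \<omega>:A|P \<mu>. \<epsilon> / (1 - exp (- d)))"
    unfolding set_lebesgue_integral_def
  proof (rule integral_mono_AE)
    show "integrable (P \<mu>) (\<lambda>\<omega>. indicat_real A \<omega> *\<^sub>R real_cond_exp (P \<mu>) ?G (indicat_real ?D) \<omega>)"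
      using fs.real_cond_exp_int(1)[OF intD] AP by (rule integrable_mult_indicator[rotated])
    show "integrable (P \<mu>) (\<lambda>\<omega>. indicat_real A \<omega> *\<^sub>R (\<epsilon> / (1 - exp (- d))))"
      using AP by (intro integrable_mult_indicator) auto
    show "AE \<omega> in P \<mu>. indicat_real A \<omega> *\<^sub>R real_cond_exp (P \<mu>) ?G (indicat_real ?D) \<omega>
        \<le> indicat_real A \<omega> *\<^sub>R (\<epsilon> / (1 - exp (- d)))"
      using ce AE_space
    proof eventually_elim
      case (elim \<omega>)
      have "real_cond_exp (P \<mu>) ?G (indicat_real ?D) \<omega> \<le> \<epsilon> / (1 - exp (- d))" if "\<omega> \<in> A"
      proof -
        have wN: "\<omega> \<in> space N" using elim space_P[OF \<mu>] by simp
        have "{\<omega>' \<in> space N. X (t - s) \<omega>' \<in> ?B} = {\<omega>' \<in> space N. d < measure (X (t - s) \<omega>') UNIV}"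
          using X_in_space_MF st by auto
        then have "real_cond_exp (P \<mu>) ?G (indicat_real ?D) \<omega> \<le> measure (X s \<omega>) UNIV / (1 - exp (- d))"
          using elim mass_tail_le[OF X_in_space_MF[OF wN st(1)] _ d, of "t - s"] st by simp
        also have "\<dots> \<le> \<epsilon> / (1 - exp (- d))"
          using small[OF that] d by (intro divide_right_mono) auto
        finally show ?thesis .
      qed
      then show ?case by (auto simp: indicator_def)
    qed
  qed
  also have "\<dots> = \<epsilon> / (1 - exp (- d)) * measure (P \<mu>) A"
    using AP by (simp add: set_lebesgue_integral_def mult.commute)
  finally show ?thesis .
qed

text \<open>Decompose according to the first time of the grid at which the mass is below \<open>\<epsilon>\<close>.\<close>

lemma grid_mass_tail_le:
  fixes \<tau> :: "nat \<Rightarrow> real"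
  assumes \<mu>: "\<mu> \<in> space MF" and \<tau>: "\<And>k. 0 \<le> \<tau> k" "\<And>k. k \<le> n \<Longrightarrow> \<tau> k \<le> t" "mono \<tau>"
    and d: "0 < d" and \<epsilon>: "0 < \<epsilon>"
  shows "measure (P \<mu>) {\<omega> \<in> space N. (\<exists>k\<le>n. measure (X (\<tau> k) \<omega>) UNIV < \<epsilon>) \<and> d < measure (X t \<omega>) UNIV}
    \<le> \<epsilon> / (1 - exp (- d))"
proof -
  interpret p: prob_space "P \<mu>" by (rule prob_space_P[OF \<mu>])
  let ?m = "\<lambda>k \<omega>. measure (X (\<tau> k) \<omega>) UNIV"
  let ?D = "{\<omega> \<in> space N. d < measure (X t \<omega>) UNIV}"
  \<comment> \<open>The event that k is the first index with mass below \<epsilon>. Only masses up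
    to time \<tau> k enter, so it belongs to the sigma-algebra at that time, as the Markov bound
    requires.\<close>
  define A where "A k = {\<omega> \<in> space N. ?m k \<omega> < \<epsilon> \<and> (\<forall>j<k. \<not> ?m j \<omega> < \<epsilon>)}" for k
  have A: "A k \<in> sets (F (\<tau> k))" for k
  proof -
    have m[measurable]: "?m j \<in> borel_measurable (F (\<tau> k))" if "j \<le> k" for j
    proof -
      have "sets (F (\<tau> j)) \<subseteq> sets (F (\<tau> k))" using \<tau>(3) that by (intro sets_F_mono) (auto dest: monoD)
      then show ?thesis using measurable_total_mass[OF \<tau>(1)[of j]] by (auto simp: measurable_def space_F)
    qed
    have "A k = {\<omega> \<in> space (F (\<tau> k)). ?m k \<omega> < \<epsilon>} \<inter>
        (\<Inter>j\<in>{..<k}. {\<omega> \<in> space (F (\<tau> k)). \<not> ?m j \<omega> < \<epsilon>}) \<inter> space (F (\<tau> k))"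
      by (auto simp: A_def space_F)
    also have "\<dots> \<in> sets (F (\<tau> k))"
    proof (cases "k = 0")
      case False
      have "{\<omega> \<in> space (F (\<tau> k)). \<not> ?m j \<omega> < \<epsilon>} \<in> sets (F (\<tau> k))" if "j \<le> k" for j
        using m[OF that] by measurable
      moreover have "{\<omega> \<in> space (F (\<tau> k)). ?m k \<omega> < \<epsilon>} \<in> sets (F (\<tau> k))"
        using m[of k] by measurable
      ultimately show ?thesis using False
        by (intro sets.Int sets.top sets.finite_INT) auto
    qed (use m[of 0] in simp)
    finally show ?thesis .
  qed
  have DP: "?D \<in> sets (P \<mu>)"
  proof -
    have [measurable]: "(\<lambda>\<omega>. measure (X t \<omega>) UNIV) \<in> borel_measurable (P \<mu>)"
      using measurable_F_P[OF \<mu> measurable_total_mass[of t]] \<tau>(1)[of 0] \<tau>(2)[of 0] by simp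
    show ?thesis unfolding space_P[OF \<mu>, symmetric] by measurable
  qed
  have AP: "A k \<in> sets (P \<mu>)" for k
    using A sets_F_subset sets_P[OF \<mu>] by blast
  have disj: "disjoint_family_on A {..n}"
  proof -
    have "A i \<inter> A j = {}" if "i < j" for i j
      using that by (auto simp: A_def)
    then show ?thesis
      unfolding disjoint_family_on_def by (metis inf_commute nat_neq_iff)
  qed
  have "{\<omega> \<in> space N. (\<exists>k\<le>n. ?m k \<omega> < \<epsilon>) \<and> d < measure (X t \<omega>) UNIV} \<subseteq> (\<Union>k\<in>{..n}. A k \<inter> ?D)"
  proof
    fix \<omega> assume w: "\<omega> \<in> {\<omega> \<in> space N. (\<exists>k\<le>n. ?m k \<omega> < \<epsilon>) \<and> d < measure (X t \<omega>) UNIV}"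
    let ?k = "LEAST k. ?m k \<omega> < \<epsilon>"
    from w obtain k where k: "k \<le> n" "?m k \<omega> < \<epsilon>" by auto
    have "\<omega> \<in> A ?k"
    proof -
      have "?m ?k \<omega> < \<epsilon>" by (rule LeastI[of "\<lambda>k. ?m k \<omega> < \<epsilon>", OF k(2)])
      moreover have "\<not> ?m j \<omega> < \<epsilon>" if "j < ?k" for j
        using not_less_Least[OF that] .
      ultimately show ?thesis using w unfolding A_def by blast
    qed
    moreover have "?k \<le> n" using Least_le[of "\<lambda>k. ?m k \<omega> < \<epsilon>" k] k by linarith
    ultimately show "\<omega> \<in> (\<Union>k\<in>{..n}. A k \<inter> ?D)" using w by blast
  qed
  then have "measure (P \<mu>) {\<omega> \<in> space N. (\<exists>k\<le>n. ?m k \<omega> < \<epsilon>) \<and> d < measure (X t \<omega>) UNIV}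
      \<le> measure (P \<mu>) (\<Union>k\<in>{..n}. A k \<inter> ?D)"
    using AP DP by (intro p.finite_measure_mono) auto
  also have "\<dots> \<le> (\<Sum>k\<in>{..n}. measure (P \<mu>) (A k \<inter> ?D))"
    using AP DP by (intro p.finite_measure_subadditive_finite) auto
  also have "\<dots> \<le> (\<Sum>k\<in>{..n}. \<epsilon> / (1 - exp (- d)) * measure (P \<mu>) (A k))"
    using markov_mass_tail_le[OF \<mu> \<tau>(1) \<tau>(2) d A] by (intro sum_mono) (auto simp: A_def)
  \<comment> \<open>By disjointness the probabilities sum to at most 1, so the bound does not grow
    with the number of grid points and the grid may be refined.\<close>
  also have "\<dots> = \<epsilon> / (1 - exp (- d)) * measure (P \<mu>) (\<Union>k\<in>{..n}. A k)"
    using AP disj by (subst p.finite_measure_finite_Union) (auto simp: sum_distrib_left)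
  also have "\<dots> \<le> \<epsilon> / (1 - exp (- d)) * 1"
    using d \<epsilon> by (intro mult_left_mono p.prob_le_1) auto
  finally show ?thesis by simp
qed

end

section \<open>From grid times to all times\<close>

lemma (in finite_measure) AE_not_if_small_cover:
  assumes "\<And>e::real. 0 < e \<Longrightarrow> \<exists>G\<in>sets M. measure M G \<le> e \<and> (AE \<omega> in M. Q \<omega> \<longrightarrow> \<omega> \<in> G)"
  shows "AE \<omega> in M. \<not> Q \<omega>"
proof -
  have "\<forall>i::nat. \<exists>G. G \<in> sets M \<and> measure M G \<le> inverse (real (Suc i)) \<and> (AE \<omega> in M. Q \<omega> \<longrightarrow> \<omega> \<in> G)"
    using assms[of "inverse (real (Suc _))"] by (auto simp del: of_nat_Suc)
  then obtain G where G: "\<And>i::nat. G i \<in> sets M" "\<And>i. measure M (G i) \<le> inverse (real (Suc i))"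
    and cover: "\<And>i. AE \<omega> in M. Q \<omega> \<longrightarrow> \<omega> \<in> G i"
    by metis
  \<comment> \<open>The set described by \<open>Q\<close> may fail to be measurable. The
    intersection of the measurable covers is a null set that contains it up to a null set.\<close>
  let ?H = "\<Inter>i. G i"
  have H: "?H \<in> sets M" using G by auto
  have "measure M ?H \<le> inverse (real (Suc i))" for i
    using finite_measure_mono[of ?H "G i"] G[of i] by (meson INT_lower UNIV_I order_trans)
  then have "measure M ?H \<le> 0"
    by (intro LIMSEQ_le_const[OF LIMSEQ_inverse_real_of_nat]) auto
  then have "emeasure M ?H = 0"
    by (simp add: emeasure_eq_measure measure_le_0_iff)
  then have "?H \<in> null_sets M" using H by auto
  then show ?thesis
  proof -
    have "AE \<omega> in M. \<forall>i. Q \<omega> \<longrightarrow> \<omega> \<in> G i"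
      using cover by (subst AE_all_countable) blast
    then show ?thesis
      using AE_not_in[OF \<open>?H \<in> null_sets M\<close>] by eventually_elim blast
  qed
qed

text \<open>The mesh is made smaller than both \<delta> and u - s, and k is the first index whose
  grid point lies strictly to the right of s. The bound by u - s keeps that point below u, hence k
  <= 2^n.\<close>

lemma dyadic_between:
  fixes s u \<delta> :: real
  assumes "0 \<le> s" "s < u" "0 < \<delta>"
  obtains n k :: nat where "k \<le> 2 ^ n" "s < u * k / 2 ^ n" "u * k / 2 ^ n < s + \<delta>"
proof -
  define e where "e = min \<delta> (u - s)"
  have e: "0 < e" "e \<le> \<delta>" "e \<le> u - s" using assms by (auto simp: e_def)
  obtain n :: nat where "u / e < 2 ^ n" using real_arch_pow[of 2 "u / e"] by auto
  then have n: "u / 2 ^ n < e" using e by (simp add: field_simps)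
  define k where "k = nat \<lfloor>s * 2 ^ n / u\<rfloor> + 1"
  have "0 \<le> s * 2 ^ n / u" using assms by auto
  then have k: "real k = of_int \<lfloor>s * 2 ^ n / u\<rfloor> + 1" by (simp add: k_def)
  then have k1: "s * 2 ^ n / u < real k" and k2: "real k \<le> s * 2 ^ n / u + 1" by linarith+
  have u: "0 < u" using assms by linarith
  have 1: "s < u * k / 2 ^ n" using k1 u by (simp add: field_simps)
  have "u * k \<le> s * 2 ^ n + u" using mult_left_mono[OF k2, of u] u by (simp add: distrib_left)
  then have 2: "u * k / 2 ^ n \<le> s + u / 2 ^ n" by (simp add: field_simps)
  then have "u * k / 2 ^ n < u" using n e by linarith
  then have "real k < 2 ^ n" using u by (simp add: field_simps)
  then have "k \<le> 2 ^ n" by (metis of_nat_less_numeral_power_cancel_iff less_imp_le)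
  with 1 2 n e show ?thesis by (intro that[of k n]) auto
qed

lemma cadlag_mass_tendsto_at_right:
  assumes w: "cadlag w" and t: "0 \<le> t"
  shows "((\<lambda>s. measure (w s) UNIV) \<longlongrightarrow> measure (w t) UNIV) (at_right t)"
proof -
  have "\<forall>\<^sub>F s in at_right t. integral\<^sup>L (w s) (\<lambda>_. 1 :: real) = measure (w s) UNIV"
    using t cadlag_finite_borel_measure[OF w]
    unfolding eventually_at_filter
    by (intro always_eventually allI impI integral_one_finite_borel_measure) auto
  moreover have "((\<lambda>s. integral\<^sup>L (w s) (\<lambda>_. 1 :: real)) \<longlongrightarrow> measure (w t) UNIV) (at_right t)"
    using cadlag_integral_tendsto_at_right[OF w t one_bounded_continuous]
      integral_one_finite_borel_measure[OF cadlag_finite_borel_measure[OF w t]] by simp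
  ultimately show ?thesis by (rule Lim_transform_eventually[rotated])
qed

context super_brownian_motion
begin

text \<open>If the mass vanishes at s < u, right-continuity keeps it below \<epsilon> just after s,
  hence at some dyadic grid point. The event for each grid has probability at most e by the choice
  of \<epsilon>, and the grids are nested, so the increasing union over all levels obeys the same
  bound.\<close>

lemma AE_mass_zero_at:
  assumes \<mu>: "\<mu> \<in> space MF" and u: "0 < u" and d: "0 < d"
  shows "AE \<omega> in P \<mu>. \<not> ((\<exists>s\<ge>0. s < u \<and> measure (X s \<omega>) UNIV = 0) \<and> d < measure (X u \<omega>) UNIV)"
proof -
  interpret p: prob_space "P \<mu>" by (rule prob_space_P[OF \<mu>])
  show ?thesis
  proof (rule p.AE_not_if_small_cover)
    fix e :: real assume e: "0 < e"
    define \<epsilon> where "\<epsilon> = e * (1 - exp (- d))"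
    have \<epsilon>: "0 < \<epsilon>" "\<epsilon> / (1 - exp (- d)) = e" using e d by (auto simp: \<epsilon>_def)
    define G where "G n = {\<omega> \<in> space N. (\<exists>k\<le>2 ^ n. measure (X (u * real k / 2 ^ n) \<omega>) UNIV < \<epsilon>) \<and>
      d < measure (X u \<omega>) UNIV}" for n :: nat
    have m[measurable]: "(\<lambda>\<omega>. measure (X t \<omega>) UNIV) \<in> borel_measurable (P \<mu>)" if "0 \<le> t" for t
      using measurable_F_P[OF \<mu> measurable_total_mass[OF that]] .
    have G: "G n \<in> sets (P \<mu>)" for n
    proof -
      have [measurable]: "(\<lambda>\<omega>. measure (X u \<omega>) UNIV) \<in> borel_measurable (P \<mu>)"
        "(\<lambda>\<omega>. measure (X (u * real k / 2 ^ n) \<omega>) UNIV) \<in> borel_measurable (P \<mu>)" for k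
        using u by (auto intro!: m)
      show ?thesis
        unfolding G_def space_P[OF \<mu>, symmetric] by measurable
    qed
    have meas: "measure (P \<mu>) (G n) \<le> e" for n
      unfolding \<epsilon>(2)[symmetric] G_def
    proof (rule grid_mass_tail_le[OF \<mu> _ _ _ d \<epsilon>(1)])
      show "0 \<le> u * real k / 2 ^ n" for k using u by simp
      show "u * real k / 2 ^ n \<le> u" if "k \<le> 2 ^ n" for k
      proof -
        have "real k \<le> 2 ^ n" using that by (metis of_nat_le_iff of_nat_numeral of_nat_power)
        then show ?thesis using u by (simp add: field_simps)
      qed
      show "mono (\<lambda>k. u * real k / 2 ^ n)"
        using u by (intro monoI divide_right_mono mult_left_mono) auto
    qed
    have inc: "incseq G"
    proof (rule incseq_SucI)
      fix n
      show "G n \<subseteq> G (Suc n)"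
      proof
        fix \<omega> assume "\<omega> \<in> G n"
        then obtain k where k: "k \<le> 2 ^ n" "measure (X (u * real k / 2 ^ n) \<omega>) UNIV < \<epsilon>"
          and r: "\<omega> \<in> space N" "d < measure (X u \<omega>) UNIV" by (auto simp: G_def)
        have "u * real (2 * k) / 2 ^ Suc n = u * real k / 2 ^ n" by simp
        with k r show "\<omega> \<in> G (Suc n)"
          unfolding G_def by (intro CollectI conjI exI[of _ "2 * k"]) auto
      qed
    qed
    have "(\<lambda>n. measure (P \<mu>) (G n)) \<longlonglongrightarrow> measure (P \<mu>) (\<Union>n. G n)"
      using G inc by (intro p.finite_Lim_measure_incseq) auto
    then have "measure (P \<mu>) (\<Union>n. G n) \<le> e"
      using meas by (intro LIMSEQ_le_const2) auto
    moreover have "AE \<omega> in P \<mu>. (\<exists>s\<ge>0. s < u \<and> measure (X s \<omega>) UNIV = 0) \<and> d < measure (X u \<omega>) UNIV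
        \<longrightarrow> \<omega> \<in> (\<Union>n. G n)"
    proof (rule AE_I2, rule impI, elim conjE exE)
      fix \<omega> s
      assume w: "\<omega> \<in> space (P \<mu>)" and s: "0 \<le> s" "s < u" "measure (X s \<omega>) UNIV = 0"
        and du: "d < measure (X u \<omega>) UNIV"
      have wN: "\<omega> \<in> space N" using w space_P[OF \<mu>] by simp
      have "((\<lambda>r. measure (X r \<omega>) UNIV) \<longlongrightarrow> 0) (at_right s)"
        using cadlag_mass_tendsto_at_right[OF cadlag_paths[OF wN] s(1)] s(3) by simp
      then have "\<forall>\<^sub>F r in at_right s. measure (X r \<omega>) UNIV < \<epsilon>"
        using \<epsilon>(1) by (rule order_tendstoD)
      then obtain b where b: "s < b" "\<And>r. s < r \<Longrightarrow> r < b \<Longrightarrow> measure (X r \<omega>) UNIV < \<epsilon>"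
        unfolding eventually_at_right_field by blast
      obtain n k where "k \<le> 2 ^ n" "s < u * real k / 2 ^ n" "u * real k / 2 ^ n < s + (b - s)"
        by (rule dyadic_between[OF s(1,2), of "b - s"]) (use b in auto)
      with b(2)[of "u * real k / 2 ^ n"] wN du have "\<omega> \<in> G n"
        unfolding G_def by auto
      then show "\<omega> \<in> (\<Union>n. G n)" by blast
    qed
    ultimately show "\<exists>H\<in>sets (P \<mu>). measure (P \<mu>) H \<le> e \<and>
        (AE \<omega> in P \<mu>. (\<exists>s\<ge>0. s < u \<and> measure (X s \<omega>) UNIV = 0) \<and> d < measure (X u \<omega>) UNIV \<longrightarrow> \<omega> \<in> H)"
      using G by (intro bexI[of _ "\<Union>n. G n"] conjI) auto
  qed
qed

text \<open>Rational times and thresholds 1/(i+1) leave only countably many null sets. A positive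
  mass at t persists at some rational r > t by right-continuity and exceeds one of the thresholds
  there.\<close>

lemma AE_absorbed_at_zero:
  assumes \<mu>: "\<mu> \<in> space MF"
  shows "AE \<omega> in P \<mu>. \<forall>s\<ge>0. \<forall>t\<ge>s. measure (X s \<omega>) UNIV = 0 \<longrightarrow> measure (X t \<omega>) UNIV = 0"
proof -
  have "AE \<omega> in P \<mu>. \<forall>r\<in>{r\<in>\<rat>. 0 < r}. \<forall>i::nat.
      \<not> ((\<exists>s\<ge>0. s < r \<and> measure (X s \<omega>) UNIV = 0) \<and> inverse (real (Suc i)) < measure (X r \<omega>) UNIV)"
  proof (subst AE_ball_countable)
    show "countable {r \<in> \<rat>. 0 < (r::real)}"
      using countable_rat by (rule countable_subset[rotated]) auto
    show "\<forall>r\<in>{r \<in> \<rat>. 0 < r}. AE \<omega> in P \<mu>. \<forall>i::nat.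
      \<not> ((\<exists>s\<ge>0. s < r \<and> measure (X s \<omega>) UNIV = 0) \<and> inverse (real (Suc i)) < measure (X r \<omega>) UNIV)"
    proof
      fix r :: real assume "r \<in> {r \<in> \<rat>. 0 < r}"
      then have "0 < r" by simp
      then show "AE \<omega> in P \<mu>. \<forall>i::nat.
        \<not> ((\<exists>s\<ge>0. s < r \<and> measure (X s \<omega>) UNIV = 0) \<and> inverse (real (Suc i)) < measure (X r \<omega>) UNIV)"
        by (intro AE_all_countable[THEN iffD2] allI AE_mass_zero_at[OF \<mu>]) auto
    qed
  qed
  then show ?thesis
    using AE_space
  proof eventually_elim
    case (elim \<omega>)
    have wN: "\<omega> \<in> space N" using elim space_P[OF \<mu>] by simp
    show ?case
    proof (intro allI impI, rule ccontr)
      fix s t :: real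
      assume st: "0 \<le> s" "s \<le> t" and s: "measure (X s \<omega>) UNIV = 0" and t: "measure (X t \<omega>) UNIV \<noteq> 0"
      have t0: "0 \<le> t" using st by simp
      have "0 < measure (X t \<omega>) UNIV" using t by (simp add: less_le)
      with cadlag_mass_tendsto_at_right[OF cadlag_paths[OF wN] t0]
      have "\<forall>\<^sub>F r in at_right t. 0 < measure (X r \<omega>) UNIV"
        by (rule order_tendstoD)
      then obtain b where b: "t < b" "\<And>r. t < r \<Longrightarrow> r < b \<Longrightarrow> 0 < measure (X r \<omega>) UNIV"
        unfolding eventually_at_right_field by blast
      obtain r where r: "r \<in> \<rat>" "t < r" "r < b" using Rats_dense_in_real[OF b(1)] by blast
      obtain i :: nat where "inverse (real (Suc i)) < measure (X r \<omega>) UNIV"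
        using reals_Archimedean[OF b(2)[OF r(2,3)]] by blast
      moreover have "s < r" "0 < r" using st r by auto
      ultimately show False using elim(1) r(1) st(1) s by blast
    qed
  qed
qed

end

section \<open>Laplace functional of the total occupation density\<close>

text \<open>An abstraction of the total local time: T is a time with zero mass, such as the
  extinction time. Once zero is absorbing, the occupation density up to T is the density over all
  times.\<close>

definition occupation_density :: "(real \<Rightarrow> real measure) \<Rightarrow> (real \<Rightarrow> real) \<Rightarrow> bool" where
  "occupation_density w \<rho> \<longleftrightarrow> \<rho> \<in> borel_measurable borel \<and> (\<forall>y. 0 \<le> \<rho> y) \<and>
     (\<exists>T\<ge>0. measure (w T) UNIV = 0 \<and> (\<forall>\<phi>\<in>borel_measurable borel.
       (\<integral>\<^sup>+s\<in>{0..T}. (\<integral>\<^sup>+x. \<phi> x \<partial>w s) \<partial>lborel) = (\<integral>\<^sup>+x. \<phi> x * ennreal (\<rho> x) \<partial>lborel)))"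

text \<open>From T on the path is the zero measure. The terminal term then vanishes for every
  \<open>V\<close>, and the time integral keeps its value at T, which the occupation formula turns
  into a space integral.\<close>

lemma occupation_exponent_eventually:
  assumes w: "cadlag w" and absorbed: "\<And>s t. 0 \<le> s \<Longrightarrow> s \<le> t \<Longrightarrow> measure (w s) UNIV = 0 \<Longrightarrow> measure (w t) UNIV = 0"
    and dens: "occupation_density w \<rho>"
    and f: "f \<in> bounded_continuous_functions" and f0: "\<And>y. 0 \<le> f y"
  shows "\<forall>\<^sub>F n in sequentially. integral\<^sup>L (w (real n)) V + (LINT s:{0..real n}|lborel. integral\<^sup>L (w s) f) =
    (LINT y|lborel. f y * \<rho> y)"
proof -
  from dens obtain T where T: "0 \<le> T" "measure (w T) UNIV = 0"
    and \<rho>[measurable]: "\<rho> \<in> borel_measurable borel" and \<rho>0: "\<And>y. 0 \<le> \<rho> y"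
    and occ: "\<And>\<phi>. \<phi> \<in> borel_measurable borel \<Longrightarrow>
       (\<integral>\<^sup>+s\<in>{0..T}. (\<integral>\<^sup>+x. \<phi> x \<partial>w s) \<partial>lborel) = (\<integral>\<^sup>+x. \<phi> x * ennreal (\<rho> x) \<partial>lborel)"
    unfolding occupation_density_def by blast
  have [measurable]: "f \<in> borel_measurable borel"
    using f by (auto simp: bounded_continuous_functions_def intro: borel_measurable_continuous_onI)
  obtain C where C: "\<And>y. \<bar>f y\<bar> \<le> C"
    using f by (auto simp: bounded_continuous_functions_def bounded_iff)
  have fin: "finite_measure (w s)" "sets (w s) = sets borel" "space (w s) = UNIV" if "0 \<le> s" for s
    using cadlag_finite_borel_measure[OF w that] sets_eq_imp_space_eq[of "w s" borel]
    by (auto simp: finite_borel_measures_def)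
  have null: "emeasure (w s) (space (w s)) = 0" if "T \<le> s" for s
    using absorbed[OF T(1) that T(2)] fin[of s] that T(1)
    by (simp add: finite_measure.emeasure_eq_measure)
  have AE_null: "AE y in w s. Q y" if "T \<le> s" for s Q
    using null[OF that] by (intro AE_I[of _ _ "space (w s)"]) auto
  have pos: "ennreal (integral\<^sup>L (w s) f) = (\<integral>\<^sup>+x. ennreal (f x) \<partial>w s)" if "0 \<le> s" for s
  proof -
    interpret finite_measure "w s" by (rule fin[OF that])
    have "f \<in> borel_measurable (w s)"
      using fin(2)[OF that] measurable_cong_sets[of "w s" borel borel borel] by simp
    then have "integrable (w s) f"
      using C by (intro integrable_const_bound[of f C]) auto
    then show ?thesis using f0 by (intro nn_integral_eq_integral[symmetric]) auto
  qed
  have main: "integral\<^sup>L (w t) V + (LINT s:{0..t}|lborel. integral\<^sup>L (w s) f) = (LINT y|lborel. f y * \<rho> y)"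
    if t: "T \<le> t" for t
  proof -
    have "integral\<^sup>L (w t) V = 0"
      by (rule integral_eq_zero_AE[OF AE_null[OF t]])
    \<comment> \<open>Both Bochner integrals are compared as \<open>enn2real\<close> of nonnegative
      integrals, the form in which the occupation formula is stated; an infinite value would become
      0 on both sides alike.\<close>
    moreover have "(LINT s:{0..t}|lborel. integral\<^sup>L (w s) f) =
        enn2real (\<integral>\<^sup>+s. ennreal (indicator {0..t} s * integral\<^sup>L (w s) f) \<partial>lborel)"
      unfolding set_lebesgue_integral_def real_scaleR_def
    proof (rule integral_eq_nn_integral)
      have "(\<lambda>s. indicator {0..t} s * (indicator {0..} s * integral\<^sup>L (w s) f)) \<in> borel_measurable borel"
        using cadlag_integral_measurable[OF w f] by measurable
      also have "(\<lambda>s. indicator {0..t} s * (indicator {0..} s * integral\<^sup>L (w s) f)) =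
          (\<lambda>s. indicator {0..t} s * integral\<^sup>L (w s) f)"
        by (auto simp: indicator_def)
      finally show "(\<lambda>s. indicator {0..t} s * integral\<^sup>L (w s) f) \<in> borel_measurable lborel" by simp
      show "AE s in lborel. 0 \<le> indicator {0..t} s * integral\<^sup>L (w s) f"
        using f0 by (intro AE_I2 mult_nonneg_nonneg integral_nonneg_AE) auto
    qed
    moreover have "(\<integral>\<^sup>+s. ennreal (indicator {0..t} s * integral\<^sup>L (w s) f) \<partial>lborel) =
        (\<integral>\<^sup>+s\<in>{0..T}. (\<integral>\<^sup>+x. ennreal (f x) \<partial>w s) \<partial>lborel)"
    proof (rule nn_integral_cong)
      fix s :: real
      consider "s < 0" | "0 \<le> s" "s \<le> T" | "T < s" by linarith
      then show "ennreal (indicator {0..t} s * integral\<^sup>L (w s) f) =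
          (\<integral>\<^sup>+x. ennreal (f x) \<partial>w s) * indicator {0..T} s"
      proof cases
        case 2
        then show ?thesis using t pos by (auto simp: indicator_def)
      next
        case 3
        then have "integral\<^sup>L (w s) f = 0"
          by (intro integral_eq_zero_AE AE_null) auto
        then show ?thesis using 3 by (auto simp: indicator_def)
      qed (auto simp: indicator_def)
    qed
    moreover have "\<dots> = (\<integral>\<^sup>+y. ennreal (f y * \<rho> y) \<partial>lborel)"
      using occ[of "\<lambda>y. ennreal (f y)"] f0 \<rho>0 by (simp add: ennreal_mult)
    moreover have "(LINT y|lborel. f y * \<rho> y) = enn2real (\<integral>\<^sup>+y. ennreal (f y * \<rho> y) \<partial>lborel)"
      using f0 \<rho>0 by (intro integral_eq_nn_integral) auto
    ultimately show ?thesis by simp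
  qed
  obtain n0 :: nat where n0: "T \<le> real n0" using real_arch_simple by blast
  have "integral\<^sup>L (w (real n)) V + (LINT s:{0..real n}|lborel. integral\<^sup>L (w s) f) =
    (LINT y|lborel. f y * \<rho> y)" if "n0 \<le> n" for n
    using that n0 by (intro main) (simp add: order_trans[OF n0])
  then show ?thesis
    unfolding eventually_sequentially by blast
qed

context super_brownian_motion
begin

text \<open>With the stationary \<open>V\<close> as terminal function the Laplace functional equals
  exp(-V x) at every time. Almost surely the exponents are eventually constant along integer times,
  so dominated convergence carries this value to the limit.\<close>

lemma exp_occupation_version:
  assumes dens: "AE \<omega> in P (return borel x). occupation_density (\<lambda>t. X t \<omega>) (\<rho> \<omega>)"
    and V: "mild_solution \<beta> V f (\<lambda>_. V)" "bounded_borel_nonneg V"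
    and f: "continuous_on UNIV f" "\<And>y. 0 \<le> f y" "\<And>y. f y \<le> C"
  obtains E where "E \<in> borel_measurable (P (return borel x))"
    and "integrable (P (return borel x)) E"
    and "integral\<^sup>L (P (return borel x)) E = exp (- V x)"
    and "AE \<omega> in P (return borel x). E \<omega> = exp (- (LINT y|lborel. f y * \<rho> \<omega> y))"
proof -
  let ?\<mu> = "return borel x"
  have \<mu>: "?\<mu> \<in> space MF" by (simp add: space_MF return_in_finite_borel_measures)
  interpret p: prob_space "P ?\<mu>" by (rule prob_space_P[OF \<mu>])
  have fb: "f \<in> bounded_continuous_functions"
    using f by (intro bounded_continuous_functionsI[of f C]) auto
  have fm: "bounded_borel_nonneg f"
    using f unfolding bounded_borel_nonneg_def bounded_iff
    by (auto intro: borel_measurable_continuous_onI)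
  define Z where "Z n \<omega> = exp (- integral\<^sup>L (X (real n) \<omega>) V - (LINT s:{0..real n}|lborel. integral\<^sup>L (X s \<omega>) f))"
    for n \<omega>
  have EZ: "integral\<^sup>L (P ?\<mu>) (Z n) = exp (- V x)" for n
  proof -
    have "V \<in> borel_measurable borel" using V(2) by (simp add: bounded_borel_nonneg_def)
    then have "integral\<^sup>L ?\<mu> V = V x" by (intro integral_return) auto
    then show ?thesis
      unfolding Z_def using laplace_functional[OF \<mu> V(2) fm V(1), of "real n"] by simp
  qed
  \<comment> \<open>The default value 0 again: the integral is exp(-V x) > 0, so \<open>Z n\<close>
    is integrable and in particular measurable.\<close>
  have intZ: "integrable (P ?\<mu>) (Z n)" for n
  proof (rule ccontr)
    assume "\<not> integrable (P ?\<mu>) (Z n)"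
    from not_integrable_integral_eq[OF this] have "exp (- V x) = 0" unfolding EZ .
    then show False by simp
  qed
  then have [measurable]: "Z n \<in> borel_measurable (P ?\<mu>)" for n by auto
  \<comment> \<open>Defining the limit through the measurable \<open>Z n\<close> gives measurability
    without any assumption on how \<open>\<rho> \<omega>\<close> depends on \<omega>.\<close>
  define E where "E \<omega> = lim (\<lambda>n. Z n \<omega>)" for \<omega>
  have Em: "E \<in> borel_measurable (P ?\<mu>)"
    unfolding E_def by measurable
  have limZ: "AE \<omega> in P ?\<mu>. (\<lambda>n. Z n \<omega>) \<longlonglongrightarrow> exp (- (LINT y|lborel. f y * \<rho> \<omega> y))"
    using dens AE_absorbed_at_zero[OF \<mu>] AE_space
  proof eventually_elim
    case (elim \<omega>)
    have wN: "\<omega> \<in> space N" using elim space_P[OF \<mu>] by simp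
    have "\<forall>\<^sub>F n in sequentially. integral\<^sup>L (X (real n) \<omega>) V +
        (LINT s:{0..real n}|lborel. integral\<^sup>L (X s \<omega>) f) = (LINT y|lborel. f y * \<rho> \<omega> y)"
      by (rule occupation_exponent_eventually[OF cadlag_paths[OF wN] _ elim(1) fb f(2)]) (use elim(2) in blast)
    then have "\<forall>\<^sub>F n in sequentially. exp (- (LINT y|lborel. f y * \<rho> \<omega> y)) = Z n \<omega>"
    proof eventually_elim
      case (elim n)
      show ?case unfolding Z_def elim[symmetric] by (simp add: algebra_simps)
    qed
    then show ?case by (rule Lim_transform_eventually[OF tendsto_const])
  qed
  have EE: "AE \<omega> in P ?\<mu>. E \<omega> = exp (- (LINT y|lborel. f y * \<rho> \<omega> y))"
    using limZ unfolding E_def by eventually_elim (rule limI)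
  have bd: "AE \<omega> in P ?\<mu>. norm (Z n \<omega>) \<le> 1" for n
    using AE_space
  proof eventually_elim
    case (elim \<omega>)
    have "0 \<le> integral\<^sup>L (X (real n) \<omega>) V"
      using V(2) by (intro integral_nonneg_AE AE_I2) (auto simp: bounded_borel_nonneg_def)
    moreover have "0 \<le> (LINT s:{0..real n}|lborel. integral\<^sup>L (X s \<omega>) f)"
      unfolding set_lebesgue_integral_def using f(2)
      by (intro integral_nonneg_AE AE_I2 scaleR_nonneg_nonneg) auto
    ultimately show ?case unfolding Z_def by simp
  qed
  have "AE \<omega> in P ?\<mu>. (\<lambda>n. Z n \<omega>) \<longlonglongrightarrow> E \<omega>"
    using limZ EE by eventually_elim simp
  note dct = this bd Em
  have "integrable (P ?\<mu>) E"
    by (rule integrable_dominated_convergence[OF Em _ _ dct(1,2)]) auto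
  moreover have "(\<lambda>n. integral\<^sup>L (P ?\<mu>) (Z n)) \<longlonglongrightarrow> integral\<^sup>L (P ?\<mu>) E"
    by (rule integral_dominated_convergence[OF Em _ _ dct(1,2)]) auto
  then have "integral\<^sup>L (P ?\<mu>) E = exp (- V x)"
    unfolding EZ by (metis LIMSEQ_unique tendsto_const)
  ultimately show ?thesis
    using EE by (intro that[OF Em])
qed

end

section \<open>The edge of the support\<close>

text \<open>Mean value theorem, with the derivative largest in size at the left endpoint. It
  supplies the factor a in the probability bound of \<open>edge_cover\<close>.\<close>

lemma powr_minus_diff_le:
  fixes x a q :: real
  assumes "0 < x" "0 < a" "0 < q"
  shows "x powr - q - (x + a) powr - q \<le> q * x powr (- q - 1) * a"
proof -
  have "\<exists>z>x. z < x + a \<and> (x + a) powr - q - x powr - q = (x + a - x) * (- q * z powr (- q - 1))"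
    using assms by (intro MVT2) (auto intro!: derivative_eq_intros)
  then obtain z where z: "x < z" "(x + a) powr - q - x powr - q = a * (- q * z powr (- q - 1))"
    by auto
  have "z powr (- q - 1) \<le> x powr (- q - 1)"
    using z assms by (intro powr_mono2') auto
  then have "a * (q * z powr (- q - 1)) \<le> a * (q * x powr (- q - 1))"
    using assms by (intro mult_left_mono) auto
  then show ?thesis using z(2) by (simp add: mult_ac)
qed

lemma exp_minus_diff_le:
  fixes u v :: real
  assumes "0 \<le> u"
  shows "exp (- u) - exp (- v) \<le> \<bar>v - u\<bar>"
proof (cases "u \<le> v")
  case True
  have "exp (- u) - exp (- v) = exp (- u) * (1 - exp (- (v - u)))"
    by (simp add: right_diff_distrib flip: exp_add)
  also have "\<dots> \<le> 1 * (v - u)"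
  proof (rule mult_mono)
    show "1 - exp (- (v - u)) \<le> v - u"
      using exp_ge_add_one_self[of "- (v - u)"] by linarith
  qed (use True assms in auto)
  finally show ?thesis using True by simp
next
  case False
  then have "exp (- u) \<le> exp (- v)" by simp
  then show ?thesis by linarith
qed

text \<open>The coordinate \<sigma> y treats both edges alike: the edge is the point \<sigma> R, a
  right end for \<sigma> = 1 and a left end for \<sigma> = -1. The opposite end stays
  existential.\<close>

definition supported_on :: "real \<Rightarrow> real \<Rightarrow> (real \<Rightarrow> real) \<Rightarrow> bool" where
  "supported_on \<sigma> R \<rho> \<longleftrightarrow> continuous_on UNIV \<rho> \<and> (\<forall>y. 0 \<le> \<rho> y) \<and>
     (\<exists>l<R. \<forall>y. 0 < \<rho> y \<longleftrightarrow> l < \<sigma> * y \<and> \<sigma> * y < R)"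

lemma abs_one_cases: "\<bar>\<sigma>::real\<bar> = 1 \<Longrightarrow> \<sigma> = 1 \<or> \<sigma> = -1"
  by linarith

lemma supported_on_integrable:
  assumes \<sigma>: "\<bar>\<sigma>\<bar> = 1" and \<rho>: "supported_on \<sigma> R \<rho>"
  shows "integrable lborel \<rho>"
proof -
  obtain l where l: "\<And>y. 0 < \<rho> y \<longleftrightarrow> l < \<sigma> * y \<and> \<sigma> * y < R" and \<rho>0: "\<And>y. 0 \<le> \<rho> y"
    and cont: "continuous_on UNIV \<rho>"
    using \<rho> unfolding supported_on_def by blast
  define B where "B = \<bar>l\<bar> + \<bar>R\<bar>"
  have "\<rho> y = 0" if "y \<notin> {- B..B}" for y
  proof -
    have "\<not> (l < \<sigma> * y \<and> \<sigma> * y < R)"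
      using that abs_one_cases[OF \<sigma>] unfolding B_def by auto
    then show ?thesis using l[of y] \<rho>0[of y] by linarith
  qed
  then have eq: "indicator {- B..B} y *\<^sub>R \<rho> y = \<rho> y" for y
    by (auto simp: indicator_def)
  have "set_integrable lborel {- B..B} \<rho>"
    by (rule borel_integrable_atLeastAtMost') (rule continuous_on_subset[OF cont], simp)
  then show ?thesis
    unfolding set_integrable_def eq .
qed

lemma integrable_bounded_mult:
  fixes g \<rho> :: "real \<Rightarrow> real"
  assumes [measurable]: "g \<in> borel_measurable borel" and \<rho>: "integrable lborel \<rho>"
    and g: "\<And>y. \<bar>g y\<bar> \<le> C"
  shows "integrable lborel (\<lambda>y. g y * \<rho> y)"
proof (rule Bochner_Integration.integrable_bound[where f="\<lambda>y. C * \<rho> y"])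
  have [measurable]: "\<rho> \<in> borel_measurable borel" using \<rho> by auto
  show "(\<lambda>y. g y * \<rho> y) \<in> borel_measurable lborel" by measurable
  show "AE y in lborel. norm (g y * \<rho> y) \<le> norm (C * \<rho> y)"
  proof (intro AE_I2)
    fix y
    have "\<bar>g y\<bar> \<le> \<bar>C\<bar>" using g[of y] by linarith
    then show "norm (g y * \<rho> y) \<le> norm (C * \<rho> y)"
      by (auto simp: abs_mult intro: mult_right_mono)
  qed
qed (use \<rho> in simp)

lemma integral_pos_of_pos_on_interval:
  fixes h :: "real \<Rightarrow> real"
  assumes h: "integrable lborel h" "\<And>y. 0 \<le> h y" and ab: "a < b" and \<sigma>: "\<bar>\<sigma>\<bar> = 1"
    and pos: "\<And>y. a < \<sigma> * y \<Longrightarrow> \<sigma> * y < b \<Longrightarrow> 0 < h y"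
  shows "0 < integral\<^sup>L lborel h"
proof -
  obtain a' b' where ab': "a' < b'" "\<And>y. y \<in> {a'<..<b'} \<Longrightarrow> 0 < h y"
  proof (cases "\<sigma> = 1")
    case True
    then show ?thesis using that[of a b] ab pos by auto
  next
    case False
    then have "\<sigma> = -1" using \<sigma> by linarith
    then show ?thesis using that[of "-b" "-a"] ab pos by auto
  qed
  have "integral\<^sup>L lborel h \<noteq> 0"
  proof
    assume "integral\<^sup>L lborel h = 0"
    then have "AE y in lborel. h y = 0"
      using integral_nonneg_eq_0_iff_AE[OF h(1)] h(2) by simp
    then have "AE y in lborel. y \<notin> {a'<..<b'}"
      by eventually_elim (use ab'(2) in force)
    then have "{a'<..<b'} \<in> null_sets lborel"
      by (subst AE_iff_null_sets) auto
    then show False using ab'(1) by (auto simp: null_sets_def)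
  qed
  moreover have "0 \<le> integral\<^sup>L lborel h" using h(2) by simp
  ultimately show ?thesis by linarith
qed

text \<open>The positivity of this tail drives the Laplace exponent to infinity as a tends to 0 when
  x < R.\<close>

lemma supported_on_tail_integral_pos:
  assumes \<sigma>: "\<bar>\<sigma>\<bar> = 1" and \<rho>: "supported_on \<sigma> R \<rho>" and z: "z < R"
  shows "0 < (LINT y|lborel. indicator {y. z \<le> \<sigma> * y} y * \<rho> y)"
proof -
  obtain l where l: "l < R" "\<And>y. 0 < \<rho> y \<longleftrightarrow> l < \<sigma> * y \<and> \<sigma> * y < R" and \<rho>0: "\<And>y. 0 \<le> \<rho> y"
    using \<rho> unfolding supported_on_def by blast
  show ?thesis
  proof (rule integral_pos_of_pos_on_interval[OF _ _ _ \<sigma>])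
    show "integrable lborel (\<lambda>y. indicator {y. z \<le> \<sigma> * y} y * \<rho> y)"
      by (rule integrable_bounded_mult[OF _ supported_on_integrable[OF \<sigma> \<rho>], of _ 1]) (auto simp: indicator_def)
    show "max l z < R" using l z by simp
    fix y assume "max l z < \<sigma> * y" "\<sigma> * y < R"
    then show "0 < indicator {y. z \<le> \<sigma> * y} y * \<rho> y" using l(2)[of y] by simp
  qed (use \<rho>0 in simp)
qed

section \<open>Laplace exponentials attached to an edge\<close>

context super_brownian_motion
begin

text \<open>As \<open>a \<rightarrow> 0\<close>, the variable \<open>E\<close> tends to the indicator of \<open>R \<le> x\<close>. It is a measurable version
  of the Laplace exponential, since the null sets of the law need not be complete.\<close>

definition edge_exponential ::
  "('w \<Rightarrow> real \<Rightarrow> real) \<Rightarrow> real \<Rightarrow> real \<Rightarrow> real \<Rightarrow> real \<Rightarrow> real \<Rightarrow> real \<Rightarrow> (real \<Rightarrow> real) \<Rightarrow> ('w \<Rightarrow> real) \<Rightarrow> bool"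
  where "edge_exponential \<rho> \<sigma> c \<kappa> K x a f E \<longleftrightarrow>
    f \<in> borel_measurable borel \<and> (\<forall>y. 0 \<le> f y \<and> f y \<le> K * a powr (- (2 / \<beta>) - 2)) \<and>
    (\<forall>y. \<sigma> * y \<le> x \<longrightarrow> f y = 0) \<and>
    (\<forall>y. x \<le> \<sigma> * y \<longrightarrow>
       \<kappa> * a powr (- (2 / \<beta>) - 2) * (1 - exp (- 2 * ((\<sigma> * y - x) / a))) \<le> f y) \<and>
    integrable (P (return borel 0)) E \<and>
    integral\<^sup>L (P (return borel 0)) E = exp (- (c * (x + a) powr - (2 / \<beta>))) \<and>
    (AE \<omega> in P (return borel 0). E \<omega> = exp (- (LINT y|lborel. f y * \<rho> \<omega> y)))"

lemma edge_exponential_exists: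
  assumes \<beta>: "0 < \<beta>" and \<sigma>: "\<bar>\<sigma>\<bar> = 1"
    and dens: "AE \<omega> in P (return borel 0). occupation_density (\<lambda>t. X t \<omega>) (\<rho> \<omega>)"
  obtains c \<kappa> K where "0 < c" "0 < \<kappa>" "0 < K"
    "\<And>x a. 0 \<le> x \<Longrightarrow> 0 < a \<Longrightarrow> \<exists>f E. edge_exponential \<rho> \<sigma> c \<kappa> K x a f E"
proof -
  obtain c \<kappa> K where pos: "0 < c" "0 < \<kappa>" "0 < K" and sol:
    "\<And>x a. 0 \<le> x \<Longrightarrow> 0 < a \<Longrightarrow> \<exists>V f. mild_solution \<beta> V f (\<lambda>_. V) \<and> bounded_borel_nonneg V \<and>
       continuous_on UNIV f \<and> (\<forall>y. 0 \<le> f y \<and> f y \<le> K * a powr (- (2 / \<beta>) - 2)) \<and>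
       (\<forall>y. \<sigma> * y \<le> x \<longrightarrow> f y = 0) \<and>
       (\<forall>y. x \<le> \<sigma> * y \<longrightarrow>
         \<kappa> * a powr (- (2 / \<beta>) - 2) * (1 - exp (- 2 * ((\<sigma> * y - x) / a))) \<le> f y) \<and>
       V 0 = c * (x + a) powr - (2 / \<beta>)"
    using stationary_solution_exists[OF \<beta> \<sigma>] by metis
  show ?thesis
  proof (rule that[OF pos])
    fix x a :: real assume xa: "0 \<le> x" "0 < a"
    from sol[OF xa] obtain V f where V: "mild_solution \<beta> V f (\<lambda>_. V)" "bounded_borel_nonneg V"
      and f: "continuous_on UNIV f" and fb: "\<forall>y. 0 \<le> f y \<and> f y \<le> K * a powr (- (2 / \<beta>) - 2)"
      and f2: "\<forall>y. \<sigma> * y \<le> x \<longrightarrow> f y = 0" "\<forall>y. x \<le> \<sigma> * y \<longrightarrow>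
         \<kappa> * a powr (- (2 / \<beta>) - 2) * (1 - exp (- 2 * ((\<sigma> * y - x) / a))) \<le> f y"
      and V0: "V 0 = c * (x + a) powr - (2 / \<beta>)"
      by blast
    obtain E where "integrable (P (return borel 0)) E"
      "integral\<^sup>L (P (return borel 0)) E = exp (- V 0)"
      "AE \<omega> in P (return borel 0). E \<omega> = exp (- (LINT y|lborel. f y * \<rho> \<omega> y))"
      using exp_occupation_version[OF dens V f, of "K * a powr (- (2 / \<beta>) - 2)"] fb by metis
    then have "edge_exponential \<rho> \<sigma> c \<kappa> K x a f E"
      unfolding edge_exponential_def using fb f2 borel_measurable_continuous_onI[OF f] V0 by metis
    then show "\<exists>f E. edge_exponential \<rho> \<sigma> c \<kappa> K x a f E" by blast
  qed
qed

text \<open>Beyond the midpoint of x and R the distance from x is at least (R - x)/2. As a <= 1, the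
  factor 1 - exp(...) in the source is then at least 1 - exp(-(R - x)), and a^(-q-2) with q =
  2/\<beta> is at least 1/a. The exponent thus grows at least like 1/a.\<close>

lemma edge_exponential_exponent_ge:
  assumes \<sigma>: "\<bar>\<sigma>\<bar> = 1" and \<beta>: "0 < \<beta>" and \<kappa>: "0 < \<kappa>"
    and \<rho>: "supported_on \<sigma> R \<rho>'" and x: "x < R" and a: "0 < a" "a \<le> 1"
    and E: "edge_exponential \<rho> \<sigma> c \<kappa> K x a f E"
  shows "inverse a * (\<kappa> * (1 - exp (- (R - x)))
      * (LINT y|lborel. indicator {y. (x + R) / 2 \<le> \<sigma> * y} y * \<rho>' y)) \<le> (LINT y|lborel. f y * \<rho>' y)"
proof -
  let ?S = "{y. (x + R) / 2 \<le> \<sigma> * y}"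
  note int = supported_on_integrable[OF \<sigma> \<rho>]
  have f[measurable]: "f \<in> borel_measurable borel"
    and fb: "\<And>y. 0 \<le> f y" "\<And>y. f y \<le> K * a powr (- (2 / \<beta>) - 2)"
    and fl: "\<And>y. x \<le> \<sigma> * y \<Longrightarrow>
       \<kappa> * a powr (- (2 / \<beta>) - 2) * (1 - exp (- 2 * ((\<sigma> * y - x) / a))) \<le> f y"
    using E unfolding edge_exponential_def by blast+
  have \<rho>0: "0 \<le> \<rho>' y" for y using \<rho> by (simp add: supported_on_def)
  have ia: "inverse a \<le> a powr (- (2 / \<beta>) - 2)"
  proof -
    have "0 < 2 / \<beta>" using \<beta> by simp
    then have "a powr - 1 \<le> a powr (- (2 / \<beta>) - 2)"
      using a by (intro powr_mono') linarith+
    then show ?thesis using a by (simp add: powr_minus)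
  qed
  have le: "inverse a * (\<kappa> * (1 - exp (- (R - x)))) * indicator ?S y \<le> f y" for y
  proof (cases "y \<in> ?S")
    case True
    then have y: "(R - x) / 2 \<le> \<sigma> * y - x" by (simp add: field_simps)
    define t where "t = (\<sigma> * y - x) / a"
    have "(R - x) / 2 \<le> t"
      unfolding t_def using y a x mult_mono[of "(R - x) / 2" "\<sigma> * y - x" a 1] by (simp add: pos_le_divide_eq)
    then have "- 2 * t \<le> - (R - x)" by (simp add: field_simps)
    then have "exp (- 2 * ((\<sigma> * y - x) / a)) \<le> exp (- (R - x))"
      unfolding t_def by (simp only: exp_le_cancel_iff)
    then have "inverse a * \<kappa> * (1 - exp (- (R - x)))
        \<le> a powr (- (2 / \<beta>) - 2) * \<kappa> * (1 - exp (- 2 * ((\<sigma> * y - x) / a)))"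
      using ia a \<kappa> x by (intro mult_mono) auto
    also have "\<dots> \<le> f y" using fl[of y] y x by (simp add: mult_ac)
    finally show ?thesis using True by (simp add: mult_ac)
  qed (use fb in simp)
  have "inverse a * (\<kappa> * (1 - exp (- (R - x))) * (LINT y|lborel. indicator ?S y * \<rho>' y)) =
      (LINT y|lborel. (inverse a * (\<kappa> * (1 - exp (- (R - x))))) * (indicator ?S y * \<rho>' y))"
    by (subst integral_mult_right_zero) (simp only: mult.assoc)
  also have "\<dots> \<le> (LINT y|lborel. f y * \<rho>' y)"
  proof (rule integral_mono)
    show "integrable lborel (\<lambda>y. inverse a * (\<kappa> * (1 - exp (- (R - x)))) * (indicator ?S y * \<rho>' y))"
      by (intro integrable_mult_right integrable_bounded_mult[OF _ int, of _ 1]) (auto simp: indicator_def)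
    show "integrable lborel (\<lambda>y. f y * \<rho>' y)"
      by (rule integrable_bounded_mult[OF f int, of "K * a powr (- (2 / \<beta>) - 2)"]) (use fb in simp)
    show "inverse a * (\<kappa> * (1 - exp (- (R - x)))) * (indicator ?S y * \<rho>' y) \<le> f y * \<rho>' y" for y
      using mult_right_mono[OF le[of y] \<rho>0[of y]] by (simp add: mult.assoc)
  qed
  finally show ?thesis .
qed

text \<open>The source lives strictly beyond x and the density strictly before R, so for R <= x
  their product vanishes everywhere and the exponential is 1.\<close>

lemma edge_exponential_exponent_zero:
  assumes \<rho>: "supported_on \<sigma> R \<rho>'" and x: "R \<le> x"
    and E: "edge_exponential \<rho> \<sigma> c \<kappa> K x a f E"
  shows "(LINT y|lborel. f y * \<rho>' y) = 0"
proof -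
  have fz: "\<And>y. \<sigma> * y \<le> x \<Longrightarrow> f y = 0"
    using E unfolding edge_exponential_def by blast
  obtain l where l: "\<And>y. 0 < \<rho>' y \<longleftrightarrow> l < \<sigma> * y \<and> \<sigma> * y < R" and \<rho>0: "\<And>y. 0 \<le> \<rho>' y"
    using \<rho> unfolding supported_on_def by blast
  have "f y * \<rho>' y = 0" for y
  proof (cases "\<sigma> * y \<le> x")
    case False
    then have "\<not> 0 < \<rho>' y" using l[of y] x by linarith
    then show ?thesis using \<rho>0[of y] by simp
  qed (simp add: fz)
  then show ?thesis by (simp only: Bochner_Integration.integral_zero)
qed

text \<open>Compare the exponential \<open>E'\<close> at parameter a with the limit
  \<open>E0\<close> for the parameter tending to 0, which is almost surely the indicator of R <= x.
  The difference is almost surely nonnegative, its mean exp(-c (x+a)^(-q)) - exp(-c x^(-q)) is at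
  most c q x^(-q-1) a, and Markov's inequality at level exp(-1) yields the cover.\<close>

lemma edge_cover:
  assumes \<beta>: "0 < \<beta>" and \<sigma>: "\<bar>\<sigma>\<bar> = 1"
    and dens: "AE \<omega> in P (return borel 0). occupation_density (\<lambda>t. X t \<omega>) (\<rho> \<omega>) \<and> supported_on \<sigma> (R \<omega>) (\<rho> \<omega>)"
  obtains C K where "0 < C" "0 < K"
    "\<And>x a. 0 < x \<Longrightarrow> 0 < a \<Longrightarrow> \<exists>G\<in>sets (P (return borel 0)).
       measure (P (return borel 0)) G \<le> C * x powr (- (2 / \<beta>) - 1) * a \<and>
       (AE \<omega> in P (return borel 0). x < R \<omega> \<and>
          K * a powr (- (2 / \<beta>) - 2) * (LINT y|lborel. indicator {y. x < \<sigma> * y} y * \<rho> \<omega> y) \<le> 1 \<longrightarrow> \<omega> \<in> G)"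
proof -
  let ?\<mu> = "return borel (0 :: real)"
  let ?Q = "P ?\<mu>"
  have \<mu>: "?\<mu> \<in> space MF" by (simp add: space_MF return_in_finite_borel_measures)
  interpret p: prob_space ?Q by (rule prob_space_P[OF \<mu>])
  define q where "q = 2 / \<beta>"
  have q: "0 < q" using \<beta> by (simp add: q_def)
  have "AE \<omega> in ?Q. occupation_density (\<lambda>t. X t \<omega>) (\<rho> \<omega>)"
    using dens by eventually_elim simp
  from edge_exponential_exists[OF \<beta> \<sigma> this]
  obtain c \<kappa> K where pos: "0 < c" "0 < \<kappa>" "0 < K"
    and ex: "\<And>x a. 0 \<le> x \<Longrightarrow> 0 < a \<Longrightarrow> \<exists>f E. edge_exponential \<rho> \<sigma> c \<kappa> K x a f E"
    by metis
  show ?thesis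
  proof (rule that[of "exp 1 * c * q" K])
    show "0 < exp 1 * c * q" "0 < K" using pos q by auto
    fix x a :: real assume x: "0 < x" and a: "0 < a"
    \<comment> \<open>The limit runs along the parameters 1/(m+1): they are at most 1, as the lower
      bound on the exponent requires, and their countably many null sets can be discarded
      together.\<close>
    have "\<exists>f E. edge_exponential \<rho> \<sigma> c \<kappa> K x (inverse (real (Suc m))) f E" for m
      using ex[of x "inverse (real (Suc m))"] x by simp
    then obtain f E where fE: "\<And>m. edge_exponential \<rho> \<sigma> c \<kappa> K x (inverse (real (Suc m))) (f m) (E m)"
      by metis
    obtain f' E' where fE': "edge_exponential \<rho> \<sigma> c \<kappa> K x a f' E'"
      using ex[of x a] x a by auto
    have intE: "integrable ?Q (E m)" for m
      using fE[of m] unfolding edge_exponential_def by blast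
    then have [measurable]: "E m \<in> borel_measurable ?Q" for m by auto
    have EE: "integral\<^sup>L ?Q (E m) = exp (- (c * (x + inverse (real (Suc m))) powr - q))" for m
      using fE[of m] unfolding edge_exponential_def q_def by blast
    have Eeq: "AE \<omega> in ?Q. \<forall>m. E m \<omega> = exp (- (LINT y|lborel. f m y * \<rho> \<omega> y))"
      using fE unfolding edge_exponential_def AE_all_countable by blast
    have E'int: "integrable ?Q E'" and E'E: "integral\<^sup>L ?Q E' = exp (- (c * (x + a) powr - q))"
      and E'eq: "AE \<omega> in ?Q. E' \<omega> = exp (- (LINT y|lborel. f' y * \<rho> \<omega> y))"
      and f'm: "f' \<in> borel_measurable borel" and f'b: "\<And>y. 0 \<le> f' y" "\<And>y. f' y \<le> K * a powr (- q - 2)"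
      and f'z: "\<And>y. \<sigma> * y \<le> x \<Longrightarrow> f' y = 0"
      using fE' unfolding edge_exponential_def q_def by blast+
    define E0 where "E0 \<omega> = lim (\<lambda>m. E m \<omega>)" for \<omega>
    have E0m[measurable]: "E0 \<in> borel_measurable ?Q"
      unfolding E0_def by measurable
    have lim: "AE \<omega> in ?Q. (\<lambda>m. E m \<omega>) \<longlonglongrightarrow> (if x < R \<omega> then 0 else 1)"
      using dens Eeq
    proof eventually_elim
      case (elim \<omega>)
      then have supp: "supported_on \<sigma> (R \<omega>) (\<rho> \<omega>)" by simp
      show ?case
      proof (cases "x < R \<omega>")
        case True
        let ?I = "\<kappa> * (1 - exp (- (R \<omega> - x)))
          * (LINT y|lborel. indicator {y. (x + R \<omega>) / 2 \<le> \<sigma> * y} y * \<rho> \<omega> y)"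
        have "0 < ?I"
          using True pos supported_on_tail_integral_pos[OF \<sigma> supp, of "(x + R \<omega>) / 2"]
          by (intro mult_pos_pos) auto
        then have "filterlim (\<lambda>m. ?I * real (Suc m)) at_top sequentially"
          by (rule filterlim_tendsto_pos_mult_at_top[OF tendsto_const _
              filterlim_compose[OF filterlim_real_sequentially filterlim_Suc]])
        moreover have "?I * real (Suc m) \<le> (LINT y|lborel. f m y * \<rho> \<omega> y)" for m
          using edge_exponential_exponent_ge[OF \<sigma> \<beta> pos(2) supp True _ _ fE[of m]]
          by (simp add: mult.commute inverse_le_1_iff del: of_nat_Suc)
        ultimately have "filterlim (\<lambda>m. LINT y|lborel. f m y * \<rho> \<omega> y) at_top sequentially"
          by (rule filterlim_at_top_mono[OF _ always_eventually[OF allI]])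
        then have "filterlim (\<lambda>m. - (LINT y|lborel. f m y * \<rho> \<omega> y)) at_bot sequentially"
          by (simp only: filterlim_uminus_at_top)
        from filterlim_compose[OF exp_at_bot this]
        have "(\<lambda>m. exp (- (LINT y|lborel. f m y * \<rho> \<omega> y))) \<longlonglongrightarrow> 0" .
        then show ?thesis using True elim by simp
      next
        case False
        then have "E m \<omega> = 1" for m
          using elim edge_exponential_exponent_zero[OF supp _ fE[of m]] by simp
        then show ?thesis using False by simp
      qed
    qed
    then have E0: "AE \<omega> in ?Q. E0 \<omega> = (if x < R \<omega> then 0 else 1)"
      unfolding E0_def by eventually_elim (rule limI)
    have lim0: "AE \<omega> in ?Q. (\<lambda>m. E m \<omega>) \<longlonglongrightarrow> E0 \<omega>"
      using lim E0 by eventually_elim simp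
    have bd: "AE \<omega> in ?Q. norm (E m \<omega>) \<le> 1" for m
      using Eeq dens
    proof eventually_elim
      case (elim \<omega>)
      have "0 \<le> (LINT y|lborel. f m y * \<rho> \<omega> y)"
        using fE[of m] elim unfolding edge_exponential_def supported_on_def
        by (intro integral_nonneg_AE AE_I2 mult_nonneg_nonneg) auto
      then show ?case using elim by simp
    qed
    have E0int: "integrable ?Q E0"
      by (rule integrable_dominated_convergence[OF E0m _ _ lim0 bd]) auto
    have "(\<lambda>m. integral\<^sup>L ?Q (E m)) \<longlonglongrightarrow> integral\<^sup>L ?Q E0"
      by (rule integral_dominated_convergence[OF E0m _ _ lim0 bd]) auto
    moreover have "(\<lambda>m. integral\<^sup>L ?Q (E m)) \<longlonglongrightarrow> exp (- (c * (x + 0) powr - q))"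
      unfolding EE using x
      by (intro tendsto_exp tendsto_minus tendsto_mult tendsto_const tendsto_powr tendsto_add
          LIMSEQ_inverse_real_of_nat) auto
    ultimately have E0E: "integral\<^sup>L ?Q E0 = exp (- (c * x powr - q))"
      using LIMSEQ_unique by fastforce
    \<comment> \<open>On the event to be covered \<open>E0\<close> is 0 and the exponent in
      \<open>E'\<close> is at most 1, so the difference is at least exp(-1).\<close>
    define G where "G = {\<omega> \<in> space ?Q. exp (- 1) \<le> E' \<omega> - E0 \<omega>}"
    have [measurable]: "E' \<in> borel_measurable ?Q" using E'int by auto
    have G: "G \<in> sets ?Q" unfolding G_def by measurable
    \<comment> \<open>If R <= x both exponentials are 1; otherwise \<open>E0\<close> is 0 and
      \<open>E'\<close> is positive.\<close>
    have diff0: "AE \<omega> in ?Q. 0 \<le> E' \<omega> - E0 \<omega>"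
      using E'eq E0 dens
    proof eventually_elim
      case (elim \<omega>)
      then show ?case
        using edge_exponential_exponent_zero[OF _ _ fE', of "R \<omega>" "\<rho> \<omega>"] by (cases "x < R \<omega>") auto
    qed
    have "measure ?Q G * exp (- 1) = (LINT \<omega>|?Q. indicator G \<omega> * exp (- 1))"
      using G by simp
    also have "\<dots> \<le> (LINT \<omega>|?Q. E' \<omega> - E0 \<omega>)"
    proof (rule integral_mono_AE)
      show "integrable ?Q (\<lambda>\<omega>. indicator G \<omega> * exp (- 1 :: real))"
        using G by (intro integrable_mult_left integrable_real_indicator) (auto simp: p.emeasure_eq_measure)
      show "AE \<omega> in ?Q. indicator G \<omega> * exp (- 1) \<le> E' \<omega> - E0 \<omega>"
        using diff0 by eventually_elim (auto simp: indicator_def G_def)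
    qed (use E'int E0int in simp)
    also have "\<dots> = exp (- (c * (x + a) powr - q)) - exp (- (c * x powr - q))"
      using E'int E0int E'E E0E by simp
    also have "\<dots> \<le> \<bar>c * x powr - q - c * (x + a) powr - q\<bar>"
      using pos by (intro exp_minus_diff_le) simp
    also have "\<dots> = c * (x powr - q - (x + a) powr - q)"
      using pos a x q powr_mono2'[of "- q" x "x + a"] by (simp add: abs_mult flip: right_diff_distrib)
    also have "\<dots> \<le> c * (q * x powr (- q - 1) * a)"
      using powr_minus_diff_le[OF x a q] pos by (intro mult_left_mono) auto
    finally have "exp 1 * (measure ?Q G * exp (- 1)) \<le> exp 1 * (c * (q * x powr (- q - 1) * a))"
      by (intro mult_left_mono) auto
    moreover have "exp 1 * (measure ?Q G * exp (- 1)) = measure ?Q G"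
      by (simp add: exp_minus)
    ultimately have "measure ?Q G \<le> exp 1 * c * q * x powr (- q - 1) * a"
      by (simp only: mult.assoc)
    moreover have "AE \<omega> in ?Q. x < R \<omega> \<and>
          K * a powr (- q - 2) * (LINT y|lborel. indicator {y. x < \<sigma> * y} y * \<rho> \<omega> y) \<le> 1 \<longrightarrow> \<omega> \<in> G"
      using E'eq E0 dens AE_space
    proof eventually_elim
      case (elim \<omega>)
      show ?case
      proof (rule impI, elim conjE)
        assume xR: "x < R \<omega>"
          and small: "K * a powr (- q - 2) * (LINT y|lborel. indicator {y. x < \<sigma> * y} y * \<rho> \<omega> y) \<le> 1"
        have \<rho>0: "0 \<le> \<rho> \<omega> y" for y using elim by (auto simp: supported_on_def)
        have int: "integrable lborel (\<rho> \<omega>)" using elim supported_on_integrable[OF \<sigma>] by blast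
        have "(LINT y|lborel. f' y * \<rho> \<omega> y)
            \<le> (LINT y|lborel. K * a powr (- q - 2) * (indicator {y. x < \<sigma> * y} y * \<rho> \<omega> y))"
        proof (rule integral_mono)
          show "integrable lborel (\<lambda>y. f' y * \<rho> \<omega> y)"
            by (rule integrable_bounded_mult[OF f'm int, of "K * a powr (- q - 2)"]) (use f'b in simp)
          show "integrable lborel (\<lambda>y. K * a powr (- q - 2) * (indicator {y. x < \<sigma> * y} y * \<rho> \<omega> y))"
            by (intro integrable_mult_right integrable_bounded_mult[OF _ int, of _ 1]) (auto simp: indicator_def)
          show "f' y * \<rho> \<omega> y \<le> K * a powr (- q - 2) * (indicator {y. x < \<sigma> * y} y * \<rho> \<omega> y)" for y
            using f'b(2)[of y] f'z[of y] \<rho>0[of y] by (auto simp: indicator_def intro: mult_right_mono)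
        qed
        also have "\<dots> \<le> 1" using small by simp
        finally have "exp (- 1) \<le> E' \<omega>" using elim by simp
        then show "\<omega> \<in> G" using elim xR by (simp add: G_def)
      qed
    qed
    ultimately show "\<exists>G\<in>sets ?Q. measure ?Q G \<le> exp 1 * c * q * x powr (- (2 / \<beta>) - 1) * a \<and>
       (AE \<omega> in ?Q. x < R \<omega> \<and>
          K * a powr (- (2 / \<beta>) - 2) * (LINT y|lborel. indicator {y. x < \<sigma> * y} y * \<rho> \<omega> y) \<le> 1 \<longrightarrow> \<omega> \<in> G)"
      using G unfolding q_def by blast
  qed
qed

end

section \<open>Hoelder condition at the edge and the union bound over a grid\<close>

lemma supported_on_tail_integral_le:
  assumes \<sigma>: "\<bar>\<sigma>\<bar> = 1" and \<rho>: "supported_on \<sigma> R \<rho>" and x: "x < R" "R - x \<le> \<epsilon>" and "0 < \<gamma>" "0 \<le> M"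
    and holder: "\<And>y. \<bar>y - \<sigma> * R\<bar> < \<epsilon> \<Longrightarrow> \<bar>\<rho> y - \<rho> (\<sigma> * R)\<bar> \<le> M * \<bar>y - \<sigma> * R\<bar> powr \<gamma>"
  shows "(LINT y|lborel. indicator {y. x < \<sigma> * y} y * \<rho> y) \<le> M * \<epsilon> powr (\<gamma> + 1)"
proof -
  obtain l where l: "\<And>y. 0 < \<rho> y \<longleftrightarrow> l < \<sigma> * y \<and> \<sigma> * y < R" and \<rho>0: "\<And>y. 0 \<le> \<rho> y"
    using \<rho> unfolding supported_on_def by blast
  have \<sigma>2: "\<sigma> * (\<sigma> * z) = z" for z using abs_one_cases[OF \<sigma>] by auto
  have \<epsilon>: "0 < \<epsilon>" using x by linarith
  define S where "S = {y. x < \<sigma> * y \<and> \<sigma> * y \<le> R}"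
  have "S = {x<..R} \<or> S = {- R..< - x}"
    using abs_one_cases[OF \<sigma>] by (auto simp: S_def)
  then have S: "S \<in> sets lborel" "emeasure lborel S = ennreal (R - x)" using x by auto
  have \<rho>R: "\<rho> y = 0" if "R \<le> \<sigma> * y" for y
    using l[of y] \<rho>0[of y] that by linarith
  \<comment> \<open>The density is 0 at and beyond the edge, so the Hoelder bound controls the
    density itself: it is at most M \<epsilon>^\<gamma> on a set of length R - x <=
    \<epsilon>.\<close>
  have "(LINT y|lborel. indicator {y. x < \<sigma> * y} y * \<rho> y)
      \<le> (LINT y|lborel. M * \<epsilon> powr \<gamma> * indicator S y)"
  proof (rule integral_mono)
    show "integrable lborel (\<lambda>y. indicator {y. x < \<sigma> * y} y * \<rho> y)"
      by (rule integrable_bounded_mult[OF _ supported_on_integrable[OF \<sigma> \<rho>], of _ 1]) (auto simp: indicator_def)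
    show "integrable lborel (\<lambda>y. M * \<epsilon> powr \<gamma> * indicator S y)"
      using S by (intro integrable_mult_right integrable_real_indicator) auto
    fix y
    show "indicator {y. x < \<sigma> * y} y * \<rho> y \<le> M * \<epsilon> powr \<gamma> * indicator S y"
    proof (cases "y \<in> S \<and> \<sigma> * y < R")
      case True
      have "\<bar>y - \<sigma> * R\<bar> = R - \<sigma> * y"
        using True abs_one_cases[OF \<sigma>] by (auto simp: abs_if)
      moreover have "R - \<sigma> * y < \<epsilon>" using True x unfolding S_def by simp
      ultimately have "\<bar>\<rho> y - \<rho> (\<sigma> * R)\<bar> \<le> M * (R - \<sigma> * y) powr \<gamma>"
        using holder[of y] by simp
      also have "\<dots> \<le> M * \<epsilon> powr \<gamma>"
        using \<open>R - \<sigma> * y < \<epsilon>\<close> True assms by (intro mult_left_mono powr_mono2) auto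
      also have "\<rho> (\<sigma> * R) = 0" by (rule \<rho>R) (simp add: \<sigma>2)
      finally show ?thesis using True by (simp add: S_def)
    next
      case False
      then have "indicator {y. x < \<sigma> * y} y * \<rho> y = 0"
        using \<rho>R[of y] by (cases "R \<le> \<sigma> * y") (auto simp: S_def indicator_def)
      moreover have "0 \<le> M * \<epsilon> powr \<gamma> * indicator S y" using \<open>0 \<le> M\<close> by simp
      ultimately show ?thesis by linarith
    qed
  qed
  also have "\<dots> = M * \<epsilon> powr \<gamma> * (R - x)"
    using S x by (simp add: measure_def)
  also have "\<dots> \<le> M * \<epsilon> powr \<gamma> * \<epsilon>"
    using x \<open>0 \<le> M\<close> by (intro mult_left_mono) auto
  also have "\<dots> = M * \<epsilon> powr (\<gamma> + 1)"
    using \<epsilon> by (simp add: powr_add)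
  finally show ?thesis .
qed

lemma grid_point_below:
  fixes r \<epsilon> M :: real
  assumes "0 < r" "r \<le> M" "0 < \<epsilon>"
  obtains k :: nat where "k \<le> nat \<lceil>M / \<epsilon>\<rceil>" "real k * \<epsilon> < r" "r - real k * \<epsilon> \<le> \<epsilon>"
proof -
  \<comment> \<open>The ceiling minus one gives the last grid point strictly below r, also when r
    itself is a grid point.\<close>
  define k where "k = nat (\<lceil>r / \<epsilon>\<rceil> - 1)"
  have "0 < r / \<epsilon>" using assms by simp
  then have "1 \<le> \<lceil>r / \<epsilon>\<rceil>" by linarith
  then have k: "real k = of_int \<lceil>r / \<epsilon>\<rceil> - 1" by (simp add: k_def)
  have 1: "real k < r / \<epsilon>" and 2: "r / \<epsilon> \<le> real k + 1"
    using ceiling_correct[of "r / \<epsilon>"] k by linarith+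
  have "r / \<epsilon> \<le> M / \<epsilon>" using assms by (intro divide_right_mono) auto
  then have "real k \<le> M / \<epsilon>" using 1 by linarith
  then have "k \<le> nat \<lceil>M / \<epsilon>\<rceil>" by linarith
  moreover have "real k * \<epsilon> < r" using 1 assms by (simp add: field_simps)
  moreover have "r - real k * \<epsilon> \<le> \<epsilon>" using 2 assms by (simp add: field_simps)
  ultimately show ?thesis by (rule that)
qed

context super_brownian_motion
begin

text \<open>Here b and M make the Hoelder condition quantitative: b is its radius and a lower bound
  for the edge, M its constant and an upper bound for the edge. On the bad event the grid point just
  before the edge meets the smallness condition of \<open>edge_cover\<close>, and the covers at the
  O(1/\<epsilon>) grid points have total probability at most
  \<open>D * \<epsilon> powr (p - 1)\<close>.\<close>

lemma AE_not_uniform_holder_edge: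
  assumes \<beta>: "0 < \<beta>" and \<gamma>: "1 + 2 / \<beta> < \<gamma>" and \<sigma>: "\<bar>\<sigma>\<bar> = 1"
    and dens: "AE \<omega> in P (return borel 0). occupation_density (\<lambda>t. X t \<omega>) (\<rho> \<omega>) \<and> supported_on \<sigma> (R \<omega>) (\<rho> \<omega>)"
    and b: "0 < b" and M: "0 < M"
  shows "AE \<omega> in P (return borel 0). \<not> (b < R \<omega> \<and> R \<omega> \<le> M \<and>
    (\<forall>y. \<bar>y - \<sigma> * R \<omega>\<bar> < b \<longrightarrow> \<bar>\<rho> \<omega> y - \<rho> \<omega> (\<sigma> * R \<omega>)\<bar> \<le> M * \<bar>y - \<sigma> * R \<omega>\<bar> powr \<gamma>))"
    (is "AE \<omega> in ?Q. \<not> ?bad \<omega>")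
proof -
  have \<mu>: "return borel (0 :: real) \<in> space MF" by (simp add: space_MF return_in_finite_borel_measures)
  interpret p: prob_space ?Q by (rule prob_space_P[OF \<mu>])
  define q where "q = 2 / \<beta>"
  have q: "0 < q" using \<beta> by (simp add: q_def)
  have \<gamma>0: "0 < \<gamma>" using \<gamma> q unfolding q_def by linarith
  obtain C K where C: "0 < C" and K: "0 < K" and cover: "\<And>x a. 0 < x \<Longrightarrow> 0 < a \<Longrightarrow> \<exists>G\<in>sets ?Q.
       measure ?Q G \<le> C * x powr (- q - 1) * a \<and> (AE \<omega> in ?Q. x < R \<omega> \<and>
          K * a powr (- q - 2) * (LINT y|lborel. indicator {y. x < \<sigma> * y} y * \<rho> \<omega> y) \<le> 1 \<longrightarrow> \<omega> \<in> G)"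
    by (rule edge_cover[OF \<beta> \<sigma> dens, folded q_def]) (rule that)
  \<comment> \<open>The cover needs a^(q+2) of order \<epsilon>^(\<gamma>+1), that is, a of order
    \<epsilon>^p. The bound 1 < p is exactly \<gamma> > 1 + 2/\<beta>; it makes O(1/\<epsilon>)
    events of probability O(\<epsilon>^p) negligible.\<close>
  define p where "p = (\<gamma> + 1) / (q + 2)"
  have "q + 2 < \<gamma> + 1" using \<gamma> unfolding q_def by linarith
  then have p: "1 < p" using q by (simp add: p_def less_divide_eq)
  define D where "D = (M + 1) * (C * (b / 2) powr (- q - 1)) * (K * M) powr (1 / (q + 2))"
  have D: "0 < D" using M C K b by (simp add: D_def)
  show ?thesis
  proof (rule p.AE_not_if_small_cover)
    fix e :: real assume e: "0 < e"
    \<comment> \<open>The last term forces D \<epsilon>^(p-1) <= e. The bound b/2 keeps the grid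
      point just below the edge at or above b/2, and the bound 1 absorbs the rounding in the number
      of grid points.\<close>
    define \<epsilon> where "\<epsilon> = min (min 1 (b / 2)) ((e / D) powr (1 / (p - 1)))"
    have \<epsilon>: "0 < \<epsilon>" "\<epsilon> \<le> 1" "\<epsilon> \<le> b / 2" using b e D by (auto simp: \<epsilon>_def)
    have \<epsilon>e: "D * \<epsilon> powr (p - 1) \<le> e"
    proof -
      have "\<epsilon> powr (p - 1) \<le> ((e / D) powr (1 / (p - 1))) powr (p - 1)"
        using \<epsilon>(1) p by (intro powr_mono2) (auto simp: \<epsilon>_def)
      also have "\<dots> = e / D" using p e D by (simp add: powr_powr)
      finally show ?thesis using D by (simp add: field_simps)
    qed
    \<comment> \<open>The solution of K a^(-q-2) M \<epsilon>^(\<gamma>+1) = 1, so that the Hoelder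
      bound on the mass beyond the grid point is precisely the smallness that
      \<open>edge_cover\<close> asks for.\<close>
    define a where "a = (K * M) powr (1 / (q + 2)) * \<epsilon> powr p"
    have a: "0 < a" using K M \<epsilon> by (simp add: a_def)
    have aq: "K * a powr (- q - 2) * (M * \<epsilon> powr (\<gamma> + 1)) = 1"
    proof -
      have "a powr (q + 2) = K * M * \<epsilon> powr (\<gamma> + 1)"
        using K M q by (simp add: a_def p_def powr_mult powr_powr)
      moreover have "a powr (- q - 2) = inverse (a powr (q + 2))"
        by (simp add: powr_minus[symmetric])
      ultimately show ?thesis using K M \<epsilon> by (simp add: field_simps)
    qed
    define n where "n = nat \<lceil>M / \<epsilon>\<rceil>"
    \<comment> \<open>Restricting to points at or above b/2 bounds the factor x^(-q-1) of the cover
      uniformly.\<close>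
    define I where "I = {k \<in> {1..n}. b / 2 \<le> real k * \<epsilon>}"
    have n: "real n \<le> (M + 1) / \<epsilon>"
    proof -
      have "0 < M / \<epsilon>" using M \<epsilon> by simp
      then have "real n \<le> M / \<epsilon> + 1" unfolding n_def by linarith
      also have "\<dots> \<le> M / \<epsilon> + 1 / \<epsilon>" using \<epsilon> by simp
      finally show ?thesis by (simp add: add_divide_distrib)
    qed
    define good where "good x H \<longleftrightarrow> H \<in> sets ?Q \<and> measure ?Q H \<le> C * x powr (- q - 1) * a \<and>
        (AE \<omega> in ?Q. x < R \<omega> \<and>
          K * a powr (- q - 2) * (LINT y|lborel. indicator {y. x < \<sigma> * y} y * \<rho> \<omega> y) \<le> 1 \<longrightarrow> \<omega> \<in> H)"
      for x H
    define G where "G k = (SOME H. good (real k * \<epsilon>) H)" for k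
    have good: "good (real k * \<epsilon>) (G k)" if "k \<in> I" for k
    proof -
      have "0 < real k * \<epsilon>" using that \<epsilon> unfolding I_def by simp
      from cover[OF this a] have "\<exists>H. good (real k * \<epsilon>) H"
        unfolding good_def by blast
      then show ?thesis unfolding G_def by (rule someI_ex)
    qed
    have G: "\<And>k. k \<in> I \<Longrightarrow> G k \<in> sets ?Q"
      and Gm: "\<And>k. k \<in> I \<Longrightarrow> measure ?Q (G k) \<le> C * (real k * \<epsilon>) powr (- q - 1) * a"
      and Gc: "\<And>k. k \<in> I \<Longrightarrow> AE \<omega> in ?Q. real k * \<epsilon> < R \<omega> \<and> K * a powr (- q - 2) *
          (LINT y|lborel. indicator {y. real k * \<epsilon> < \<sigma> * y} y * \<rho> \<omega> y) \<le> 1 \<longrightarrow> \<omega> \<in> G k"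
      using good unfolding good_def by blast+
    have fin: "finite I" by (simp add: I_def)
    have "measure ?Q (\<Union>k\<in>I. G k) \<le> (\<Sum>k\<in>I. measure ?Q (G k))"
      using fin G by (intro p.finite_measure_subadditive_finite) auto
    also have "\<dots> \<le> (\<Sum>k\<in>I. C * (b / 2) powr (- q - 1) * a)"
    proof (rule sum_mono)
      fix k assume k: "k \<in> I"
      have "(real k * \<epsilon>) powr (- q - 1) \<le> (b / 2) powr (- q - 1)"
        using k b q unfolding I_def by (intro powr_mono2') auto
      then have "C * (real k * \<epsilon>) powr (- q - 1) * a \<le> C * (b / 2) powr (- q - 1) * a"
        using C a by (intro mult_right_mono mult_left_mono) auto
      then show "measure ?Q (G k) \<le> C * (b / 2) powr (- q - 1) * a" using Gm[OF k] by linarith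
    qed
    also have "\<dots> = real (card I) * (C * (b / 2) powr (- q - 1) * a)" by simp
    also have "\<dots> \<le> (M + 1) / \<epsilon> * (C * (b / 2) powr (- q - 1) * a)"
    proof (rule mult_right_mono)
      have "I \<subseteq> {1..n}" by (auto simp: I_def)
      then have "card I \<le> n" using card_mono[of "{1..n}" I] by simp
      then show "real (card I) \<le> (M + 1) / \<epsilon>" using n by linarith
    qed (use C a in simp)
    also have "\<dots> = D * (\<epsilon> powr p / \<epsilon>)"
      by (simp add: D_def a_def)
    also have "\<dots> = D * \<epsilon> powr (p - 1)"
      using \<epsilon> by (simp add: powr_diff)
    also have "\<dots> \<le> e" by (rule \<epsilon>e)
    finally have "measure ?Q (\<Union>k\<in>I. G k) \<le> e" .
    moreover have "AE \<omega> in ?Q. ?bad \<omega> \<longrightarrow> \<omega> \<in> (\<Union>k\<in>I. G k)"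
    proof -
      have "AE \<omega> in ?Q. \<forall>k\<in>I. real k * \<epsilon> < R \<omega> \<and> K * a powr (- q - 2) *
          (LINT y|lborel. indicator {y. real k * \<epsilon> < \<sigma> * y} y * \<rho> \<omega> y) \<le> 1 \<longrightarrow> \<omega> \<in> G k"
        using fin Gc by (intro AE_finite_allI) auto
      then show ?thesis
        using dens
      proof eventually_elim
        case (elim \<omega>)
        show ?case
        proof
          assume bad: "?bad \<omega>"
          then have R: "0 < R \<omega>" "R \<omega> \<le> M" using b by auto
          obtain k where k: "k \<le> n" "real k * \<epsilon> < R \<omega>" "R \<omega> - real k * \<epsilon> \<le> \<epsilon>"
            using grid_point_below[OF R \<epsilon>(1)] unfolding n_def by metis
          have kb: "b / 2 \<le> real k * \<epsilon>" using k(3) \<epsilon>(3) bad by linarith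
          then have "k \<noteq> 0" using b by (intro notI) simp
          then have kI: "k \<in> I" using k(1) kb by (simp add: I_def)
          have "(LINT y|lborel. indicator {y. real k * \<epsilon> < \<sigma> * y} y * \<rho> \<omega> y) \<le> M * \<epsilon> powr (\<gamma> + 1)"
          proof (rule supported_on_tail_integral_le[OF \<sigma> _ k(2,3) \<gamma>0])
            show "supported_on \<sigma> (R \<omega>) (\<rho> \<omega>)" using elim by simp
            show "0 \<le> M" using M by simp
            show "\<bar>\<rho> \<omega> y - \<rho> \<omega> (\<sigma> * R \<omega>)\<bar> \<le> M * \<bar>y - \<sigma> * R \<omega>\<bar> powr \<gamma>" if "\<bar>y - \<sigma> * R \<omega>\<bar> < \<epsilon>" for y
              using bad that \<epsilon>(3) b by simp
          qed
          then have "K * a powr (- q - 2) * (LINT y|lborel. indicator {y. real k * \<epsilon> < \<sigma> * y} y * \<rho> \<omega> y)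
              \<le> K * a powr (- q - 2) * (M * \<epsilon> powr (\<gamma> + 1))"
            using K by (intro mult_left_mono) auto
          then show "\<omega> \<in> (\<Union>k\<in>I. G k)"
            using elim(1) kI k(2) unfolding aq by blast
        qed
      qed
    qed
    ultimately show "\<exists>H\<in>sets ?Q. measure ?Q H \<le> e \<and> (AE \<omega> in ?Q. ?bad \<omega> \<longrightarrow> \<omega> \<in> H)"
      using fin G by (intro bexI[of _ "\<Union>k\<in>I. G k"] conjI) auto
  qed
qed

text \<open>For R > 0 the pointwise condition is covered by countably many quantitative ones: a
  single integer exceeds 1/\<delta>, c, R and 1/R at once.\<close>

lemma AE_not_pointwise_holder_edge:
  assumes \<beta>: "0 < \<beta>" and \<gamma>: "1 + 2 / \<beta> < \<gamma>" and \<sigma>: "\<bar>\<sigma>\<bar> = 1"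
    and dens: "AE \<omega> in P (return borel 0). occupation_density (\<lambda>t. X t \<omega>) (\<rho> \<omega>) \<and> supported_on \<sigma> (R \<omega>) (\<rho> \<omega>)"
    and R: "AE \<omega> in P (return borel 0). 0 < R \<omega>"
  shows "AE \<omega> in P (return borel 0). \<not> pointwise_holder \<gamma> (\<rho> \<omega>) (\<sigma> * R \<omega>)"
proof -
  have "AE \<omega> in P (return borel 0). \<forall>m::nat. \<not> (inverse (real (Suc m)) < R \<omega> \<and> R \<omega> \<le> real (Suc m) \<and>
    (\<forall>y. \<bar>y - \<sigma> * R \<omega>\<bar> < inverse (real (Suc m)) \<longrightarrow>
      \<bar>\<rho> \<omega> y - \<rho> \<omega> (\<sigma> * R \<omega>)\<bar> \<le> real (Suc m) * \<bar>y - \<sigma> * R \<omega>\<bar> powr \<gamma>))"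
    unfolding AE_all_countable
    by (intro allI AE_not_uniform_holder_edge[OF \<beta> \<gamma> \<sigma> dens]) auto
  then show ?thesis
    using R
  proof eventually_elim
    case (elim \<omega>)
    show ?case
    proof
      assume "pointwise_holder \<gamma> (\<rho> \<omega>) (\<sigma> * R \<omega>)"
      then obtain \<delta> c where \<delta>: "0 < \<delta>" "0 < c" and
        h: "\<And>y. \<bar>y - \<sigma> * R \<omega>\<bar> < \<delta> \<Longrightarrow> \<bar>\<rho> \<omega> y - \<rho> \<omega> (\<sigma> * R \<omega>)\<bar> \<le> c * \<bar>y - \<sigma> * R \<omega>\<bar> powr \<gamma>"
        unfolding pointwise_holder_def by blast
      obtain m :: nat where m: "max (max (inverse \<delta>) c) (max (R \<omega>) (inverse (R \<omega>))) < real m"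
        using reals_Archimedean2 by blast
      then have m': "inverse \<delta> < real (Suc m)" "c \<le> real (Suc m)" "R \<omega> \<le> real (Suc m)" "inverse (R \<omega>) < real (Suc m)"
        by auto
      have 1: "inverse (real (Suc m)) < R \<omega>" "inverse (real (Suc m)) < \<delta>"
        using less_imp_inverse_less[OF m'(4)] less_imp_inverse_less[OF m'(1)] elim \<delta> by auto
      have "\<bar>\<rho> \<omega> y - \<rho> \<omega> (\<sigma> * R \<omega>)\<bar> \<le> real (Suc m) * \<bar>y - \<sigma> * R \<omega>\<bar> powr \<gamma>"
        if "\<bar>y - \<sigma> * R \<omega>\<bar> < inverse (real (Suc m))" for y
        using h[of y] that 1(2) mult_right_mono[OF m'(2), of "\<bar>y - \<sigma> * R \<omega>\<bar> powr \<gamma>"] by simp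
      with 1(1) m'(3) elim(1) show False by blast
    qed
  qed
qed

end

section \<open>The total local time as an occupation density\<close>

lemma total_local_time_occupation_density:
  assumes w: "cadlag (\<lambda>t. X t \<omega>)"
    and cont: "continuous_on ({0..} \<times> UNIV) (\<lambda>(t, x). L t x \<omega>)"
    and nonneg: "\<forall>t\<ge>0. \<forall>x. 0 \<le> L t x \<omega>"
    and occ: "\<forall>t\<ge>0. \<forall>\<phi>\<in>borel_measurable borel.
           (\<integral>\<^sup>+s\<in>{0..t}. (\<integral>\<^sup>+x. \<phi> x \<partial>X s \<omega>) \<partial>lborel) =
           (\<integral>\<^sup>+x. \<phi> x * ennreal (L t x \<omega>) \<partial>lborel)"
    and pos: "a < b" "{x. 0 < total_local_time X L \<omega> x} = {a<..<b}"
  shows "occupation_density (\<lambda>t. X t \<omega>) (total_local_time X L \<omega>)"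
    and "continuous_on UNIV (total_local_time X L \<omega>)"
proof -
  let ?\<rho> = "total_local_time X L \<omega>"
  let ?\<zeta> = "extinction_time X \<omega>"
  define T where "T = real_of_ereal ?\<zeta>"
  have \<rho>: "?\<rho> = (\<lambda>x. L T x \<omega>)" by (rule ext) (simp add: total_local_time_def T_def)
  have \<zeta>0: "0 \<le> ?\<zeta>"
    unfolding extinction_time_def by (intro INF_greatest) auto
  then have T0: "0 \<le> T" by (simp add: T_def real_of_ereal_pos)
  have "continuous_on UNIV (\<lambda>x. (\<lambda>(t, x). L t x \<omega>) (T, x))"
    by (rule continuous_on_compose2[OF cont]) (use T0 in \<open>auto intro!: continuous_intros\<close>)
  then show \<rho>c: "continuous_on UNIV ?\<rho>" by (simp add: \<rho>)
  then have \<rho>m: "?\<rho> \<in> borel_measurable borel" by (rule borel_measurable_continuous_onI)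
  have \<rho>0: "0 \<le> ?\<rho> x" for x using nonneg T0 by (simp add: \<rho>)
  have \<rho>occ: "(\<integral>\<^sup>+s\<in>{0..T}. (\<integral>\<^sup>+x. \<phi> x \<partial>X s \<omega>) \<partial>lborel) = (\<integral>\<^sup>+x. \<phi> x * ennreal (?\<rho> x) \<partial>lborel)"
    if "\<phi> \<in> borel_measurable borel" for \<phi>
    using occ T0 that by (simp add: \<rho>)
  \<comment> \<open>If the extinction time were infinite, \<open>real_of_ereal\<close> would give T
    = 0. The occupation formula would then integrate over a single instant, so the density would
    vanish almost everywhere, against its positivity on a nonempty interval.\<close>
  have fin: "?\<zeta> < \<infinity>"
  proof (rule ccontr)
    assume "\<not> ?\<zeta> < \<infinity>"
    then have "T = 0" by (simp add: T_def)
    have "(\<integral>\<^sup>+s\<in>{0..T}. (\<integral>\<^sup>+x. 1 \<partial>X s \<omega>) \<partial>lborel) = 0"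
    proof -
      have "(\<integral>\<^sup>+s\<in>{0..T}. (\<integral>\<^sup>+x. 1 \<partial>X s \<omega>) \<partial>lborel) = (\<integral>\<^sup>+s. 0 \<partial>(lborel :: real measure))"
      proof (rule nn_integral_cong_AE)
        have "AE s in lborel. s \<noteq> (0 :: real)" by (rule AE_lborel_singleton)
        then show "AE s in lborel. (\<integral>\<^sup>+x. 1 \<partial>X s \<omega>) * indicator {0..T} s = 0"
          by eventually_elim (use \<open>T = 0\<close> in \<open>auto simp: indicator_def\<close>)
      qed
      then show ?thesis by simp
    qed
    then have "(\<integral>\<^sup>+x. ennreal (?\<rho> x) \<partial>lborel) = 0"
      using \<rho>occ[of "\<lambda>_. 1"] by simp
    then have ae: "AE x in lborel. ?\<rho> x \<le> 0"
      using \<rho>m by (simp add: nn_integral_0_iff_AE ennreal_eq_0_iff)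
    have "0 < ?\<rho> x" if "x \<in> {a<..<b}" for x
      using pos(2) that by blast
    then have "x \<notin> {a<..<b}" if "?\<rho> x \<le> 0" for x
      using that not_le by blast
    with ae have "AE x in lborel. x \<notin> {a<..<b}"
      by (rule eventually_mono)
    then have "{a<..<b} \<in> null_sets lborel"
      by (subst AE_iff_null_sets) auto
    then show False using pos(1) by (auto simp: null_sets_def)
  qed
  have \<zeta>: "?\<zeta> = ereal T"
    using \<zeta>0 fin by (cases ?\<zeta>) (auto simp: T_def)
  \<comment> \<open>The infimum is attained: a positive mass at T would stay positive on an interval
    to the right of T, leaving no zero of the mass near the infimum.\<close>
  have "measure (X T \<omega>) UNIV = 0"
  proof (rule ccontr)
    assume ne: "measure (X T \<omega>) UNIV \<noteq> 0"
    then have "0 < measure (X T \<omega>) UNIV" by (simp add: less_le)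
    with cadlag_mass_tendsto_at_right[OF w T0]
    have "\<forall>\<^sub>F s in at_right T. 0 < measure (X s \<omega>) UNIV"
      by (rule order_tendstoD)
    then obtain u where u: "T < u" "\<And>s. T < s \<Longrightarrow> s < u \<Longrightarrow> 0 < measure (X s \<omega>) UNIV"
      unfolding eventually_at_right_field by blast
    have "(INF t\<in>{t. 0 \<le> t \<and> measure (X t \<omega>) UNIV = 0}. ereal t) < ereal u"
      using \<zeta> u(1) by (simp add: extinction_time_def)
    then obtain s where s: "0 \<le> s" "measure (X s \<omega>) UNIV = 0" "s < u"
      unfolding INF_less_iff by auto
    have "?\<zeta> \<le> ereal s"
      unfolding extinction_time_def by (rule INF_lower) (use s in simp)
    then have "T < s" using \<zeta> s(2) ne by (cases "s = T") auto
    then show False using u(2)[of s] s by simp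
  qed
  then show "occupation_density (\<lambda>t. X t \<omega>) ?\<rho>"
    unfolding occupation_density_def using \<rho>m \<rho>0 T0 \<rho>occ by blast
qed

theorem theorem1p5:
  fixes \<beta> \<gamma> :: real
    and N :: "'w measure" and F :: "real \<Rightarrow> 'w measure"
    and X :: "real \<Rightarrow> 'w \<Rightarrow> real measure"
    and P :: "real measure \<Rightarrow> 'w measure"
    and L :: "real \<Rightarrow> real \<Rightarrow> 'w \<Rightarrow> real"
    and left_end right_end :: "'w \<Rightarrow> real"
  assumes "0 < \<beta>" and "\<beta> < 1"
    and "super_brownian_motion N F \<beta> X P"
    and "jointly_continuous_local_time (P (return borel 0)) X L"
    and "left_end \<in> borel_measurable (P (return borel 0))"
    and "right_end \<in> borel_measurable (P (return borel 0))"
    and "AE \<omega> in P (return borel 0). left_end \<omega> < 0 \<and> 0 < right_end \<omega> \<and>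
           {x. 0 < total_local_time X L \<omega> x} = {left_end \<omega><..<right_end \<omega>}"
    and "\<gamma> > 1 + 2 / \<beta>"
  shows "AE \<omega> in P (return borel 0).
           \<not> pointwise_holder \<gamma> (total_local_time X L \<omega>) (left_end \<omega>) \<and>
           \<not> pointwise_holder \<gamma> (total_local_time X L \<omega>) (right_end \<omega>)"
proof -
  interpret super_brownian_motion N F \<beta> X P by fact
  let ?Q = "P (return borel 0)"
  let ?\<rho> = "total_local_time X L"
  have \<mu>: "return borel (0 :: real) \<in> space MF"
    by (simp add: space_MF return_in_finite_borel_measures)
  have "AE \<omega> in ?Q. continuous_on ({0..} \<times> UNIV) (\<lambda>(t, x). L t x \<omega>) \<and> (\<forall>t\<ge>0. \<forall>x. 0 \<le> L t x \<omega>) \<and>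
        (\<forall>t\<ge>0. \<forall>\<phi>\<in>borel_measurable borel.
           (\<integral>\<^sup>+s\<in>{0..t}. (\<integral>\<^sup>+x. \<phi> x \<partial>X s \<omega>) \<partial>lborel) =
           (\<integral>\<^sup>+x. \<phi> x * ennreal (L t x \<omega>) \<partial>lborel))"
    using assms(4) by (simp add: jointly_continuous_local_time_def)
  \<comment> \<open>Under y -> -y the left end becomes a right edge: the reflected support runs from
    \<open>- right_end \<omega>\<close> to \<open>- left_end \<omega>\<close>.\<close>
  then have main: "AE \<omega> in ?Q. (occupation_density (\<lambda>t. X t \<omega>) (?\<rho> \<omega>) \<and> supported_on 1 (right_end \<omega>) (?\<rho> \<omega>)) \<and>
      (occupation_density (\<lambda>t. X t \<omega>) (?\<rho> \<omega>) \<and> supported_on (- 1) (- left_end \<omega>) (?\<rho> \<omega>))"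
    using assms(7) AE_space
  proof eventually_elim
    case (elim \<omega>)
    have wN: "\<omega> \<in> space N" using elim space_P[OF \<mu>] by simp
    have lr: "left_end \<omega> < right_end \<omega>"
      and set: "{x. 0 < ?\<rho> \<omega> x} = {left_end \<omega><..<right_end \<omega>}" using elim by auto
    have *: "occupation_density (\<lambda>t. X t \<omega>) (?\<rho> \<omega>)" "continuous_on UNIV (?\<rho> \<omega>)"
      using total_local_time_occupation_density[OF cadlag_paths[OF wN] _ _ _ lr set] elim by blast+
    have iff: "0 < ?\<rho> \<omega> y \<longleftrightarrow> left_end \<omega> < y \<and> y < right_end \<omega>" for y
      using set by (auto simp: set_eq_iff)
    have "0 \<le> ?\<rho> \<omega> y" for y
      using *(1) by (simp add: occupation_density_def)
    moreover have "0 < ?\<rho> \<omega> y \<longleftrightarrow> - right_end \<omega> < - 1 * y \<and> - 1 * y < - left_end \<omega>" for y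
      unfolding iff by auto
    moreover have "0 < ?\<rho> \<omega> y \<longleftrightarrow> left_end \<omega> < 1 * y \<and> 1 * y < right_end \<omega>" for y
      unfolding iff by simp
    moreover have "- right_end \<omega> < - left_end \<omega>" using lr by simp
    ultimately show ?case
      using * lr unfolding supported_on_def by blast
  qed
  have "AE \<omega> in ?Q. \<not> pointwise_holder \<gamma> (?\<rho> \<omega>) (1 * right_end \<omega>)"
  proof (rule AE_not_pointwise_holder_edge[OF assms(1,8)])
    show "AE \<omega> in ?Q. occupation_density (\<lambda>t. X t \<omega>) (?\<rho> \<omega>) \<and> supported_on 1 (right_end \<omega>) (?\<rho> \<omega>)"
      using main by eventually_elim blast
    show "AE \<omega> in ?Q. 0 < right_end \<omega>" using assms(7) by eventually_elim blast
  qed simp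
  moreover have "AE \<omega> in ?Q. \<not> pointwise_holder \<gamma> (?\<rho> \<omega>) (- 1 * - left_end \<omega>)"
  proof (rule AE_not_pointwise_holder_edge[OF assms(1,8)])
    show "AE \<omega> in ?Q. occupation_density (\<lambda>t. X t \<omega>) (?\<rho> \<omega>) \<and> supported_on (- 1) (- left_end \<omega>) (?\<rho> \<omega>)"
      using main by eventually_elim blast
    show "AE \<omega> in ?Q. 0 < - left_end \<omega>" using assms(7) by eventually_elim simp
  qed simp
  ultimately show ?thesis by eventually_elim simp
qed

end
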